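(* Let $L$ be an infinite countable discrete indecomposable scattered linear order of finite Hausdorff rank. Then there is an alternating signed tree $(T,s_T)$ such that $L$ and $\mathrm{LIN}(T,s_T)$ are equimorphic.
   Context: Trees: a finite tree is a nonempty finite set $T\subseteq\omega^{<\omega}$ closed under initial segments, root $\emptyset$, $\sigma*x$ is $\sigma$ extended by $x$; in standard labelling, with $w(T;\sigma)$ the number of children of $\sigma$, $\sigma*x\in T$ iff $x<w(T;\sigma)$. A finite signed tree is $(T,s_T)$ with $s_T:T\to\{+,-\}$. It is alternating if for every $\sigma\in T$, $w(T;\sigma)$ is even and $s_T(\sigma*x)=(-1)^x$ (i.e. $+$ for even $x$, $-$ for odd $x$) for every $x<w(T;\sigma)$. $A\times B$ denotes the lexicographic product $\sum_{a\in A}B$ (first coordinate dominant); $\omega^+:=\omega$, $\omega^-:=\omega^*$ (reverse of $\omega$). $\mathrm{LIN}(T,s_T,\sigma):=\omega^{s_T(\sigma)}\times\big(\sum_{x<w(T;\sigma)}\mathrm{LIN}(T,s_T,\sigma*x)\big)$, the empty sum being $\mathbf 1$, and $\mathrm{LIN}(T,s_T):=\mathrm{LIN}(T,s_T,\emptyset)$. Two linear orders are equimorphic if each embeds (order-preservingly and injectively) into the other. Discrete: every non-maximum element has an immediate successor and every non-minimum element has an immediate predecessor. Indecomposable: whenever $L$ embeds into $A+B$, $L$ embeds into $A$ or into $B$. Scattered: $\mathbb Q$ does not embed. Hausdorff rank: $\sim_0$ is equality; for $\alpha>0$ and $x<y$, $x\sim_\alpha y$ iff for some $\beta<\alpha$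 only finitely many $\sim_\beta$-classes meet $[x,y]$; $\mathrm{rk}(L)$ is the least $\alpha$ such that the set of $\sim_\alpha$-classes is finite. *)

theory Defs
  imports Main "HOL-Library.Countable_Set" "HOL-Library.Sublist"
begin

text \<open>A linear order is a reflexive relation \<open>L\<close> with \<^prop>\<open>Linear_order L\<close>; its
  underlying set is \<^term>\<open>Field L\<close>.\<close>

definition strict :: "'a rel \<Rightarrow> 'a \<Rightarrow> 'a \<Rightarrow> bool" where
  "strict L x y \<longleftrightarrow> (x, y) \<in> L \<and> x \<noteq> y"

definition embeds :: "'a rel \<Rightarrow> 'b rel \<Rightarrow> bool" where
  "embeds L M \<longleftrightarrow> (\<exists>f. f ` Field L \<subseteq> Field M \<and> inj_on f (Field L) \<and>
     (\<forall>x y. (x, y) \<in> L \<longrightarrow> (f x, f y) \<in> M))"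

definition equimorphic :: "'a rel \<Rightarrow> 'b rel \<Rightarrow> bool" where
  "equimorphic L M \<longleftrightarrow> embeds L M \<and> embeds M L"

definition immediate_succ :: "'a rel \<Rightarrow> 'a \<Rightarrow> 'a \<Rightarrow> bool" where
  "immediate_succ L x y \<longleftrightarrow> strict L x y \<and> (\<nexists>z. strict L x z \<and> strict L z y)"

definition discrete_order :: "'a rel \<Rightarrow> bool" where
  "discrete_order L \<longleftrightarrow> (\<forall>x \<in> Field L.
     (\<not> (\<forall>y \<in> Field L. (y, x) \<in> L) \<longrightarrow> (\<exists>y. immediate_succ L x y)) \<and>
     (\<not> (\<forall>y \<in> Field L. (x, y) \<in> L) \<longrightarrow> (\<exists>y. immediate_succ L y x)))"

definition order_sum :: "'a rel \<Rightarrow> 'b rel \<Rightarrow> ('a + 'b) rel" where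
  "order_sum A B = {(Inl a, Inl a') | a a'. (a, a') \<in> A} \<union>
     {(Inr b, Inr b') | b b'. (b, b') \<in> B} \<union>
     {(Inl a, Inr b) | a b. a \<in> Field A \<and> b \<in> Field B}"

text \<open>The summands \<open>A\<close> and \<open>B\<close> range over linear orders on the type of \<open>L\<close>, since a
  definition cannot quantify over types. Nothing is lost: by \<open>indecomposable_all_types\<close> below,
  the property then holds for summands on arbitrary types.\<close>

definition indecomposable :: "'a rel \<Rightarrow> bool" where
  "indecomposable L \<longleftrightarrow> (\<forall>(A :: 'a rel) (B :: 'a rel). Linear_order A \<and> Linear_order B \<and>
     embeds L (order_sum A B) \<longrightarrow> embeds L A \<or> embeds L B)"

definition scattered :: "'a rel \<Rightarrow> bool" where
  "scattered L \<longleftrightarrow> \<not> embeds {(p :: rat, q). p \<le> q} L"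

definition segment :: "'a rel \<Rightarrow> 'a \<Rightarrow> 'a \<Rightarrow> 'a set" where
  "segment L x y = {z. (x, z) \<in> L \<and> (z, y) \<in> L \<or> (y, z) \<in> L \<and> (z, x) \<in> L}"

text \<open>The equivalence relations \<open>\<sim>\<^sub>n\<close> at finite levels, which are the only ones that
  matter for having finite Hausdorff rank. \<^term>\<open>segment L x y // hausdorff_equiv L m\<close> is the
  set of the classes that meet the closed interval between \<open>x\<close> and \<open>y\<close>.\<close>

function hausdorff_equiv :: "'a rel \<Rightarrow> nat \<Rightarrow> 'a rel" where
  "hausdorff_equiv L n =
     (if n = 0 then Id_on (Field L)
      else {(x, y) \<in> Field L \<times> Field L.
              \<exists>m \<in> {..<n}. finite (segment L x y // hausdorff_equiv L m)})"
  by pat_completeness auto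
termination
  by (relation "measure snd") auto

declare hausdorff_equiv.simps [simp del]

text \<open>The rank is the least \<open>\<alpha>\<close> with finitely many \<open>\<sim>\<^sub>\<alpha>\<close>-classes, so it
  is finite iff some natural number has this property.\<close>

definition finite_hausdorff_rank :: "'a rel \<Rightarrow> bool" where
  "finite_hausdorff_rank L \<longleftrightarrow> (\<exists>n :: nat. finite (Field L // hausdorff_equiv L n))"

datatype sign = Plus | Minus

definition num_children :: "nat list set \<Rightarrow> nat list \<Rightarrow> nat" where
  "num_children T \<sigma> = card {x. \<sigma> @ [x] \<in> T}"

definition finite_tree :: "nat list set \<Rightarrow> bool" where
  "finite_tree T \<longleftrightarrow> finite T \<and> T \<noteq> {} \<and> (\<forall>\<sigma> \<in> T. \<forall>\<tau>. prefix \<tau> \<sigma> \<longrightarrow> \<tau> \<in> T)"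

definition standard_labelling :: "nat list set \<Rightarrow> bool" where
  "standard_labelling T \<longleftrightarrow> (\<forall>\<sigma> \<in> T. \<forall>x. \<sigma> @ [x] \<in> T \<longleftrightarrow> x < num_children T \<sigma>)"

text \<open>A signed tree is a pair \<open>T\<close>, \<open>s\<close>, where only the values of \<open>s\<close> on \<open>T\<close>
  are relevant. The sign of the root is unconstrained.\<close>

definition alternating :: "nat list set \<Rightarrow> (nat list \<Rightarrow> sign) \<Rightarrow> bool" where
  "alternating T s \<longleftrightarrow> (\<forall>\<sigma> \<in> T. even (num_children T \<sigma>) \<and>
     (\<forall>x < num_children T \<sigma>. s (\<sigma> @ [x]) = (if even x then Plus else Minus)))"

fun signed_omega :: "sign \<Rightarrow> nat rel" where
  "signed_omega Plus = natLeq"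
| "signed_omega Minus = natLeq\<inverse>"

text \<open>The sum of the orders \<open>B a\<close> over \<open>a\<close> in \<open>A\<close>. So that sums can be iterated
  within one type, the pair of \<open>a\<close> and an element \<open>u\<close> of \<open>B a\<close> is coded by the
  list \<open>a # u\<close>.\<close>

definition indexed_sum :: "nat rel \<Rightarrow> (nat \<Rightarrow> nat list rel) \<Rightarrow> nat list rel" where
  "indexed_sum A B = {(a # u, b # v) | a u b v.
     a \<in> Field A \<and> b \<in> Field A \<and> u \<in> Field (B a) \<and> v \<in> Field (B b) \<and>
     (strict A a b \<or> a = b \<and> (u, v) \<in> B a)}"

lemma indexed_sum_cong [fundef_cong]:
  assumes "A = A'" and "\<And>a. a \<in> Field A' \<Longrightarrow> B a = B' a"
  shows "indexed_sum A B = indexed_sum A' B'"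
  using assms unfolding indexed_sum_def by fastforce

definition lex_product :: "nat rel \<Rightarrow> nat list rel \<Rightarrow> nat list rel" where
  "lex_product A B = indexed_sum A (\<lambda>_. B)"

definition order_one :: "nat list rel" where
  "order_one = {([], [])}"

lemma num_extensions_less:
  assumes "finite T" and "\<sigma> \<in> T"
  shows "card {\<tau> \<in> T. prefix (\<sigma> @ [x]) \<tau>} < card {\<tau> \<in> T. prefix \<sigma> \<tau>}"
proof (rule psubset_card_mono)
  have "\<sigma> \<in> {\<tau> \<in> T. prefix \<sigma> \<tau>}" "\<sigma> \<notin> {\<tau> \<in> T. prefix (\<sigma> @ [x]) \<tau>}"
    using assms by (auto dest: prefix_length_le)
  moreover have "{\<tau> \<in> T. prefix (\<sigma> @ [x]) \<tau>} \<subseteq> {\<tau> \<in> T. prefix \<sigma> \<tau>}"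
    by (auto dest: append_prefixD)
  ultimately show "{\<tau> \<in> T. prefix (\<sigma> @ [x]) \<tau>} \<subset> {\<tau> \<in> T. prefix \<sigma> \<tau>}"
    by blast
qed (use assms in simp)

text \<open>The recursion is meant for nodes of a finite tree in standard labelling; the guard
  makes it terminate, and \<open>LIN\<close> is a dummy empty order elsewhere.\<close>

function LIN :: "nat list set \<Rightarrow> (nat list \<Rightarrow> sign) \<Rightarrow> nat list \<Rightarrow> nat list rel" where
  "LIN T s \<sigma> =
     (if finite T \<and> \<sigma> \<in> T then
        lex_product (signed_omega (s \<sigma>))
          (if num_children T \<sigma> = 0 then order_one
           else indexed_sum (natLeq_on (num_children T \<sigma>)) (\<lambda>x. LIN T s (\<sigma> @ [x])))
      else {})"
  by pat_completeness auto
termination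
  by (relation "measure (\<lambda>(T, s, \<sigma>). card {\<tau> \<in> T. prefix \<sigma> \<tau>})")
     (auto intro: num_extensions_less)

declare LIN.simps [simp del]

lemma embeds_trans: "embeds L M \<Longrightarrow> embeds M N \<Longrightarrow> embeds L N"
  unfolding embeds_def
proof (elim exE conjE)
  fix f g
  assume "f ` Field L \<subseteq> Field M" "inj_on f (Field L)" "\<forall>x y. (x, y) \<in> L \<longrightarrow> (f x, f y) \<in> M"
    "g ` Field M \<subseteq> Field N" "inj_on g (Field M)" "\<forall>x y. (x, y) \<in> M \<longrightarrow> (g x, g y) \<in> N"
  then show "\<exists>h. h ` Field L \<subseteq> Field N \<and> inj_on h (Field L) \<and>
      (\<forall>x y. (x, y) \<in> L \<longrightarrow> (h x, h y) \<in> N)"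
    by (intro exI[of _ "g \<circ> f"]) (auto intro!: comp_inj_on intro: inj_on_subset simp: image_subset_iff)
qed

lemma indecomposable_all_types:
  fixes L :: "'a rel" and A :: "'b rel" and B :: "'c rel"
  assumes L: "Linear_order L" "indecomposable L" and lin: "Linear_order A" "Linear_order B"
    and emb: "embeds L (order_sum A B)"
  shows "embeds L A \<or> embeds L B"
proof -
  obtain f where f: "f ` Field L \<subseteq> Field (order_sum A B)" "inj_on f (Field L)"
      "\<And>x y. (x, y) \<in> L \<Longrightarrow> (f x, f y) \<in> order_sum A B"
    using emb unfolding embeds_def by blast
  define S where "S = {x \<in> Field L. \<exists>a. f x = Inl a}"
  define U where "U = {x \<in> Field L. \<exists>b. f x = Inr b}"
  define LA where "LA = Restr L S"
  define LB where "LB = Restr L U"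
  have refl: "(x, x) \<in> L" if "x \<in> Field L" for x
    using L(1) that
    by (auto simp: linear_order_on_def partial_order_on_def preorder_on_def refl_on_def)
  have SU: "x \<in> S \<or> x \<in> U" if "x \<in> Field L" for x
    using that unfolding S_def U_def by (cases "f x") auto
  have FA: "Field LA = S" and FB: "Field LB = U"
    using refl unfolding LA_def LB_def S_def U_def Field_def by blast+
  have lins: "Linear_order LA" "Linear_order LB"
    using Linear_order_Restr[OF L(1)] unfolding LA_def LB_def by auto
  have "(if x \<in> S then Inl x else Inr x, if y \<in> S then Inl y else Inr y) \<in> order_sum LA LB"
    if xy: "(x, y) \<in> L" for x y
  proof -
    have xyF: "x \<in> Field L" "y \<in> Field L"
      using xy by (auto intro: FieldI1 FieldI2)
    have "x \<in> S" if "y \<in> S"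
      using f(3)[OF xy] that xyF unfolding S_def order_sum_def by auto
    then show ?thesis
      using SU[OF xyF(1)] SU[OF xyF(2)] xy FA FB
      unfolding order_sum_def by (auto simp: LA_def LB_def)
  qed
  moreover from this have "(\<lambda>x. if x \<in> S then Inl x else Inr x) ` Field L
      \<subseteq> Field (order_sum LA LB)"
    using refl by (blast intro: FieldI1)
  moreover have "inj_on (\<lambda>x. if x \<in> S then Inl x else Inr x) (Field L)"
    by (auto simp: inj_on_def split: if_splits)
  ultimately have "embeds L (order_sum LA LB)"
    unfolding embeds_def by blast
  then have "embeds L LA \<or> embeds L LB"
    using L(2) lins unfolding indecomposable_def by blast
  moreover have "embeds LA A"
    unfolding embeds_def
  proof (intro exI conjI allI impI)
    show 1: "(projl (f x), projl (f y)) \<in> A" if "(x, y) \<in> LA" for x y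
      using f(3)[of x y] that unfolding LA_def S_def order_sum_def by auto
    show "(\<lambda>x. projl (f x)) ` Field LA \<subseteq> Field A"
      using 1 by (auto simp: Field_def)
    show "inj_on (\<lambda>x. projl (f x)) (Field LA)"
      using f(2) unfolding FA S_def inj_on_def by auto
  qed
  moreover have "embeds LB B"
    unfolding embeds_def
  proof (intro exI conjI allI impI)
    show 1: "(projr (f x), projr (f y)) \<in> B" if "(x, y) \<in> LB" for x y
      using f(3)[of x y] that unfolding LB_def U_def order_sum_def by auto
    show "(\<lambda>x. projr (f x)) ` Field LB \<subseteq> Field B"
      using 1 by (auto simp: Field_def)
    show "inj_on (\<lambda>x. projr (f x)) (Field LB)"
      using f(2) unfolding FB U_def inj_on_def by auto
  qed
  ultimately show ?thesis
    by (blast intro: embeds_trans)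
qed

end

theory Submission
  imports Defs
begin

text \<open>Up to equimorphism, \<open>\<omega>\<^sup>\<plusminus> \<times> (A\<^sub>1 + \<dots> + A\<^sub>k)\<close> depends only on the set of the summands:
  they may be reordered, repeated, and enlarged by any order that embeds into the sum, because
  each summand can be placed in a fresh copy of the sum. So the alternation of signs costs
  nothing once \<open>\<omega>\<close> and \<open>\<omega>\<^sup>*\<close> embed, and only finitely many trees are needed at each rank.
  By induction on \<open>n\<close>, every convex set of pairwise \<open>\<sim>\<^sub>n\<close>-equivalent elements is a finite sum of
  single points and tree orders taken from a finite set \<open>F\<close> of alternating trees. To pass to
  the next rank, write one side of such a set as an \<open>\<omega>\<close>- or \<open>\<omega>\<^sup>*\<close>-sequence of sums over \<open>F\<close>.
  From some point on, only trees that recur infinitely often occur, so a tail is a single tree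
  order; discreteness enters since an infinite interval of a discrete order contains both
  \<open>\<omega>\<close> and \<open>\<omega>\<^sup>*\<close>. Finally, an indecomposable order embeds into one of its finitely many
  summands.\<close>

section \<open>Linear orders and embeddings between subsets\<close>

lemma Linear_order_strict_trans:
  "Linear_order R \<Longrightarrow> strict R x y \<Longrightarrow> strict R y z \<Longrightarrow> strict R x z"
  unfolding strict_def order_on_defs by (metis antisymD transD)

lemma Linear_order_strict_asym:
  "Linear_order R \<Longrightarrow> strict R x y \<Longrightarrow> \<not> strict R y x"
  unfolding strict_def order_on_defs by (metis antisymD)

lemma Linear_order_strict_total:
  "Linear_order R \<Longrightarrow> x \<in> Field R \<Longrightarrow> y \<in> Field R \<Longrightarrow> x \<noteq> y \<Longrightarrow> strict R x y \<or> strict R y x"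
  unfolding strict_def order_on_defs total_on_def by blast

lemma Linear_order_refl: "Linear_order R \<Longrightarrow> x \<in> Field R \<Longrightarrow> (x, x) \<in> R"
  unfolding order_on_defs by (meson refl_onD)

lemma Linear_order_le_less:
  "Linear_order R \<Longrightarrow> (x, y) \<in> R \<longleftrightarrow> strict R x y \<or> x = y \<and> x \<in> Field R"
  unfolding strict_def by (metis FieldI1 Linear_order_refl)

lemma Linear_order_not_strict:
  "Linear_order R \<Longrightarrow> x \<in> Field R \<Longrightarrow> y \<in> Field R \<Longrightarrow> \<not> strict R x y \<longleftrightarrow> (y, x) \<in> R"
  by (metis Linear_order_le_less Linear_order_strict_asym Linear_order_strict_total)

lemma strict_Field: "strict R x y \<Longrightarrow> x \<in> Field R \<and> y \<in> Field R"
  unfolding strict_def by (auto intro: FieldI1 FieldI2)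

text \<open>Reversal exchanges \<omega> and \<open>\<omega>\<^sup>*\<close>. An argument about a
  sequence of sign \<open>s\<close> is run once, in \<open>directed s R\<close>, where the sequence
  increases.\<close>

definition directed :: "sign \<Rightarrow> 'a rel \<Rightarrow> 'a rel" where
  "directed s R = (case s of Plus \<Rightarrow> R | Minus \<Rightarrow> R\<inverse>)"

lemma directed_simps [simp]: "directed Plus R = R" "directed Minus R = R\<inverse>"
  by (simp_all add: directed_def)

lemma strict_converse [simp]: "strict (R\<inverse>) x y \<longleftrightarrow> strict R y x"
  by (auto simp: strict_def)

lemma Linear_order_directed: "Linear_order (directed s R) \<longleftrightarrow> Linear_order R"
  by (cases s) auto

lemma Field_directed: "Field (directed s R) = Field R"
  by (cases s) auto

definition before :: "'a rel \<Rightarrow> 'a set \<Rightarrow> 'a set \<Rightarrow> bool" where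
  "before R A B \<longleftrightarrow> (\<forall>a \<in> A. \<forall>b \<in> B. strict R a b)"

text \<open>Speaking of subsets avoids passing to restricted orders. Preserving the strict order
  forces injectivity on a linear order, which is why this agrees with \<open>embeds\<close> on whole
  fields (\<open>embeds_iff_emb\<close>).\<close>

definition emb :: "'a rel \<Rightarrow> 'a set \<Rightarrow> 'b rel \<Rightarrow> 'b set \<Rightarrow> bool" where
  "emb R A S B \<longleftrightarrow>
     (\<exists>f. f ` A \<subseteq> B \<and> (\<forall>x \<in> A. \<forall>y \<in> A. strict R x y \<longrightarrow> strict S (f x) (f y)))"

lemma emb_directed: "emb (directed s R) A (directed s S) B \<longleftrightarrow> emb R A S B"
  by (cases s) (simp_all add: emb_def, blast)

lemma embI:
  assumes "\<And>x. x \<in> A \<Longrightarrow> f x \<in> B"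
    and "\<And>x y. x \<in> A \<Longrightarrow> y \<in> A \<Longrightarrow> strict R x y \<Longrightarrow> strict S (f x) (f y)"
  shows "emb R A S B"
  unfolding emb_def using assms by (intro exI[of _ f] conjI ballI impI image_subsetI)

lemma embE:
  assumes "emb R A S B"
  obtains f where "\<forall>x \<in> A. f x \<in> B"
    and "\<forall>x \<in> A. \<forall>y \<in> A. strict R x y \<longrightarrow> strict S (f x) (f y)"
  using assms unfolding emb_def by (metis image_subset_iff)

lemma emb_mono: "emb R A S B \<Longrightarrow> A' \<subseteq> A \<Longrightarrow> B \<subseteq> B' \<Longrightarrow> emb R A' S B'"
  unfolding emb_def by (meson image_mono subsetD subset_trans)

lemma emb_trans:
  assumes "emb R A S B" "emb S B T C"
  shows "emb R A T C"
proof -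
  obtain f where f: "\<forall>x \<in> A. f x \<in> B"
    "\<forall>x \<in> A. \<forall>y \<in> A. strict R x y \<longrightarrow> strict S (f x) (f y)"
    using assms(1) by (rule embE)
  obtain g where g: "\<forall>x \<in> B. g x \<in> C"
    "\<forall>x \<in> B. \<forall>y \<in> B. strict S x y \<longrightarrow> strict T (g x) (g y)"
    using assms(2) by (rule embE)
  show ?thesis
    by (rule embI[of _ "\<lambda>x. g (f x)"]) (use f g in blast)+
qed

lemma emb_Un:
  assumes R: "Linear_order R" and A: "before R A1 A2" and B: "before S B1 B2"
    and e: "emb R A1 S B1" "emb R A2 S B2"
  shows "emb R (A1 \<union> A2) S (B1 \<union> B2)"
proof -
  obtain f where f: "\<forall>x \<in> A1. f x \<in> B1"
    "\<forall>x \<in> A1. \<forall>y \<in> A1. strict R x y \<longrightarrow> strict S (f x) (f y)"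
    using e(1) by (rule embE)
  obtain g where g: "\<forall>x \<in> A2. g x \<in> B2"
    "\<forall>x \<in> A2. \<forall>y \<in> A2. strict R x y \<longrightarrow> strict S (g x) (g y)"
    using e(2) by (rule embE)
  \<comment> \<open>Excludes the one case in which the glued map could fail: a point of
    \<open>A2\<close> strictly below a point of \<open>A1\<close>.\<close>
  have not: "\<not> strict R y x" if "x \<in> A1" "y \<in> A2" for x y
    using A Linear_order_strict_asym[OF R] that unfolding before_def by blast
  show ?thesis
  proof (rule embI[of _ "\<lambda>x. if x \<in> A1 then f x else g x"])
    fix x y assume "x \<in> A1 \<union> A2" "y \<in> A1 \<union> A2" "strict R x y"
    then show "strict S (if x \<in> A1 then f x else g x) (if y \<in> A1 then f y else g y)"
      using f g not B unfolding before_def by (cases "x \<in> A1"; cases "y \<in> A1") auto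
  qed (use f(1) g(1) in auto)
qed

lemma embeds_iff_emb:
  assumes R: "Linear_order R" and S: "Linear_order S"
  shows "embeds R S \<longleftrightarrow> emb R (Field R) S (Field S)"
proof
  assume "embeds R S"
  then obtain f where "f ` Field R \<subseteq> Field S" "inj_on f (Field R)" "\<forall>x y. (x, y) \<in> R \<longrightarrow> (f x, f y) \<in> S"
    unfolding embeds_def by blast
  then show "emb R (Field R) S (Field S)"
    by (intro embI[of _ f]) (auto simp: strict_def inj_on_def)
next
  assume "emb R (Field R) S (Field S)"
  then obtain f where f: "\<forall>x \<in> Field R. f x \<in> Field S"
    "\<forall>x \<in> Field R. \<forall>y \<in> Field R. strict R x y \<longrightarrow> strict S (f x) (f y)"
    by (rule embE)
  have "(f x, f y) \<in> S" if "(x, y) \<in> R" for x y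
    using that f FieldI1[OF that] FieldI2[OF that]
    unfolding Linear_order_le_less[OF R] Linear_order_le_less[OF S] by metis
  moreover have "inj_on f (Field R)"
    using f(2) Linear_order_strict_total[OF R] unfolding inj_on_def strict_def by metis
  ultimately show "embeds R S"
    using f(1) unfolding embeds_def by (intro exI[of _ f]) auto
qed

section \<open>Sequences of blocks\<close>

definition block_seq :: "sign \<Rightarrow> 'a rel \<Rightarrow> (nat \<Rightarrow> 'a set) \<Rightarrow> bool" where
  "block_seq s R B \<longleftrightarrow> (\<forall>j k. j < k \<longrightarrow> before (directed s R) (B j) (B k))"

text \<open>Any tail of the sequence of blocks contains a copy inside finitely many blocks, so
  countably many such sets can be placed one after the other.\<close>

definition absorbed :: "'a rel \<Rightarrow> 'a set \<Rightarrow> 'b rel \<Rightarrow> (nat \<Rightarrow> 'b set) \<Rightarrow> bool" where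
  "absorbed R A S B \<longleftrightarrow> (\<forall>k. \<exists>l. k \<le> l \<and> emb R A S (\<Union>j \<in> {k..<l}. B j))"

lemma absorbed_trans: "emb Q C R A \<Longrightarrow> absorbed R A S B \<Longrightarrow> absorbed Q C S B"
  unfolding absorbed_def by (meson emb_trans)

lemma absorbed_empty: "absorbed R {} S B"
  unfolding absorbed_def emb_def by auto

lemma absorbed_infinitely_often:
  assumes "\<And>k. \<exists>j \<ge> k. emb R A S (B j)"
  shows "absorbed R A S B"
  unfolding absorbed_def
proof
  fix k
  obtain j where "j \<ge> k" "emb R A S (B j)"
    using assms by blast
  moreover have "B j \<subseteq> (\<Union>j \<in> {k..<Suc j}. B j)"
    using \<open>j \<ge> k\<close> by force
  ultimately have "k \<le> Suc j \<and> emb R A S (\<Union>j \<in> {k..<Suc j}. B j)"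
    by (meson emb_mono le_SucI order_refl)
  then show "\<exists>l. k \<le> l \<and> emb R A S (\<Union>j \<in> {k..<l}. B j)" ..
qed

text \<open>\<open>A1\<close> is placed in the blocks from \<open>k\<close> to \<open>l\<close> and
  \<open>A2\<close> in blocks from \<open>l\<close> on, which lie entirely above the former.\<close>

lemma absorbed_Un_Plus:
  assumes R: "Linear_order R" and A: "before R A1 A2" and B: "block_seq Plus S B"
    and abs: "absorbed R A1 S B" "absorbed R A2 S B"
  shows "absorbed R (A1 \<union> A2) S B"
  unfolding absorbed_def
proof
  fix k
  obtain l where l: "k \<le> l" "emb R A1 S (\<Union>j \<in> {k..<l}. B j)"
    using abs(1) unfolding absorbed_def by blast
  obtain m where m: "l \<le> m" "emb R A2 S (\<Union>j \<in> {l..<m}. B j)"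
    using abs(2) unfolding absorbed_def by blast
  have "strict S x y" if "i \<in> {k..<l}" "j \<in> {l..<m}" "x \<in> B i" "y \<in> B j" for i j x y
  proof -
    have "i < j"
      using that(1,2) by simp
    then show ?thesis
      using B that(3,4) unfolding block_seq_def before_def directed_simps by blast
  qed
  then have "before S (\<Union>j \<in> {k..<l}. B j) (\<Union>j \<in> {l..<m}. B j)"
    unfolding before_def by blast
  then have "emb R (A1 \<union> A2) S ((\<Union>j \<in> {k..<l}. B j) \<union> (\<Union>j \<in> {l..<m}. B j))"
    by (intro emb_Un R A l m)
  then have "emb R (A1 \<union> A2) S (\<Union>j \<in> {k..<m}. B j)"
    unfolding UN_Un[symmetric] ivl_disj_un_two(3)[OF l(1) m(1)] .
  then show "\<exists>l. k \<le> l \<and> emb R (A1 \<union> A2) S (\<Union>j \<in> {k..<l}. B j)"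
    using l(1) m(1) le_trans by blast
qed

lemma absorbed_Un:
  assumes R: "Linear_order R" and A: "before R A1 A2" and B: "block_seq s S B"
    and abs: "absorbed R A1 S B" "absorbed R A2 S B"
  shows "absorbed R (A1 \<union> A2) S B"
proof (cases s)
  case Plus
  then show ?thesis using absorbed_Un_Plus assms by blast
next
  case Minus
  have emb: "emb (R\<inverse>) X (S\<inverse>) Y = emb R X S Y" for X Y
    using emb_directed[of Minus R X S Y] by simp
  have absorbed: "absorbed (R\<inverse>) X (S\<inverse>) B = absorbed R X S B" for X
    unfolding absorbed_def emb ..
  \<comment> \<open>In a descending sequence the upper part \<open>A2\<close> has to be placed
    first, so the two parts change roles under reversal.\<close>
  have "absorbed (R\<inverse>) (A2 \<union> A1) (S\<inverse>) B"
  proof (rule absorbed_Un_Plus)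
    show "before (R\<inverse>) A2 A1"
      using A unfolding before_def by simp
    show "block_seq Plus (S\<inverse>) B"
      using B Minus unfolding block_seq_def by simp
  qed (use R abs absorbed in simp_all)
  then show ?thesis
    by (simp only: absorbed Un_commute)
qed

text \<open>The target is cut into consecutive finite groups of blocks, and the \<open>j\<close>-th
  group receives \<open>A j\<close>. Used in both directions, this turns blockwise absorption into
  equimorphism.\<close>

lemma emb_UN_absorbed:
  assumes R: "Linear_order R" and A: "block_seq s R A" and B: "block_seq s S B"
    and abs: "\<And>k. absorbed R (A k) S B"
  shows "emb R (\<Union>k. A k) S (\<Union>k. B k)"
proof -
  define R' S' where "R' = directed s R" and "S' = directed s S"
  have emb: "emb R' X S' Y = emb R X S Y" for X Y
    unfolding R'_def S'_def by (rule emb_directed)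
  have R': "Linear_order R'"
    using R unfolding R'_def Linear_order_directed .
  \<comment> \<open>\<open>K (Suc j)\<close> is the index that the absorption of \<open>A j\<close>
    gives from \<open>K j\<close> on. The invariant of the dependent choice is trivial, hence the
    conjunct \<open>True\<close>.\<close>
  have "\<exists>K. \<forall>j. True \<and> (K j \<le> K (Suc j) \<and> emb R' (A j) S' (\<Union>i \<in> {K j..<K (Suc j)}. B i))"
    using abs unfolding absorbed_def emb by (intro dependent_nat_choice) simp_all
  then obtain K where K: "\<And>j. K j \<le> K (Suc j)" "\<And>j. emb R' (A j) S' (\<Union>i \<in> {K j..<K (Suc j)}. B i)"
    by blast
  have "\<forall>j. \<exists>g. (\<forall>x \<in> A j. g x \<in> (\<Union>i \<in> {K j..<K (Suc j)}. B i)) \<and>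
      (\<forall>x \<in> A j. \<forall>y \<in> A j. strict R' x y \<longrightarrow> strict S' (g x) (g y))"
    using K(2) unfolding emb_def image_subset_iff ..
  then obtain f where f0: "\<forall>j. (\<forall>x \<in> A j. f j x \<in> (\<Union>i \<in> {K j..<K (Suc j)}. B i)) \<and>
      (\<forall>x \<in> A j. \<forall>y \<in> A j. strict R' x y \<longrightarrow> strict S' (f j x) (f j y))"
    by (rule choice[THEN exE])
  have f: "\<exists>i. K j \<le> i \<and> i < K (Suc j) \<and> f j x \<in> B i" if "x \<in> A j" for j x
    using f0 that by (fastforce simp: Bex_def)
  have f2: "strict S' (f j x) (f j y)" if "x \<in> A j" "y \<in> A j" "strict R' x y" for j x y
    using f0 that by simp
  have monoK: "i \<le> j \<Longrightarrow> K i \<le> K j" for i j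
    using K(1) by (simp add: lift_Suc_mono_le)
  \<comment> \<open>\<open>J x\<close> names a block of the source containing \<open>x\<close>, so
    that the separate maps \<open>f j\<close> combine into one map.\<close>
  define J where "J x = (SOME j. x \<in> A j)" for x
  have J: "x \<in> A (J x)" if "x \<in> A j" for x j
    unfolding J_def using that by (rule someI)
  have "emb R' (\<Union>k. A k) S' (\<Union>k. B k)"
  proof (rule embI[of _ "\<lambda>x. f (J x) x"])
    show "f (J x) x \<in> (\<Union>k. B k)" if "x \<in> (\<Union>k. A k)" for x
      using f[OF J] that by blast
    fix x y assume xy: "x \<in> (\<Union>k. A k)" "y \<in> (\<Union>k. A k)" "strict R' x y"
    then have in_A: "x \<in> A (J x)" "y \<in> A (J y)"
      using J by blast+
    consider "J x = J y" | "J x < J y" | "J y < J x"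
      by linarith
    then show "strict S' (f (J x) x) (f (J y) y)"
    proof cases
      case 1
      then show ?thesis using f2[of x "J x" y] in_A xy(3) by simp
    next
      case 2
      obtain a b where ab: "a < K (Suc (J x))" "K (J y) \<le> b" "f (J x) x \<in> B a" "f (J y) y \<in> B b"
        using f[OF in_A(1)] f[OF in_A(2)] by blast
      have "a < b"
        using ab monoK[of "Suc (J x)" "J y"] 2 by linarith
      then show ?thesis
        using B ab unfolding block_seq_def before_def S'_def by blast
    next
      case 3
      then have "strict R' y x"
        using A in_A unfolding block_seq_def before_def R'_def by blast
      then show ?thesis
        using xy Linear_order_strict_asym[OF R'] by blast
    qed
  qed
  then show ?thesis by (simp add: emb)
qed

section \<open>Signed trees as a datatype\<close>

text \<open>Structural induction on this type replaces reasoning about sets of nodes;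
  \<open>LIN_nodes\<close> translates the outcome back.\<close>

datatype stree = Node (root_sign: sign) (children: "stree list")

text \<open>The recursive calls go through \<open>map\<close>, the form that primitive recursion
  over the nested type \<open>stree list\<close> admits.\<close>

primrec tree_order :: "stree \<Rightarrow> nat list rel" where
  "tree_order (Node s ts) = lex_product (signed_omega s)
     (if ts = [] then order_one
      else indexed_sum (natLeq_on (length ts)) (\<lambda>x. map tree_order ts ! x))"

abbreviation leaf :: "sign \<Rightarrow> stree" where
  "leaf s \<equiv> Node s []"

lemma Field_indexed_sum:
  assumes "Linear_order A" "\<And>a. a \<in> Field A \<Longrightarrow> Linear_order (B a)"
  shows "Field (indexed_sum A B) = {a # u | a u. a \<in> Field A \<and> u \<in> Field (B a)}"
proof
  show "Field (indexed_sum A B) \<subseteq> {a # u | a u. a \<in> Field A \<and> u \<in> Field (B a)}"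
    unfolding Field_def indexed_sum_def by auto
  show "{a # u | a u. a \<in> Field A \<and> u \<in> Field (B a)} \<subseteq> Field (indexed_sum A B)"
    using assms(2) Linear_order_refl by (fastforce simp: indexed_sum_def intro: FieldI1)
qed

lemma strict_indexed_sum:
  "strict (indexed_sum A B) (a # u) (b # v) \<longleftrightarrow>
     a \<in> Field A \<and> b \<in> Field A \<and> u \<in> Field (B a) \<and> v \<in> Field (B b) \<and>
     (strict A a b \<or> a = b \<and> strict (B a) u v)"
  unfolding indexed_sum_def strict_def by auto

lemma Linear_order_indexed_sum:
  assumes A: "Linear_order A" and B: "\<And>a. a \<in> Field A \<Longrightarrow> Linear_order (B a)"
  shows "Linear_order (indexed_sum A B)"
proof -
  have F: "Field (indexed_sum A B) = {a # u | a u. a \<in> Field A \<and> u \<in> Field (B a)}"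
    by (rule Field_indexed_sum[OF A B])
  have transB: "(u, w) \<in> B a" if "(u, v) \<in> B a" "(v, w) \<in> B a" "a \<in> Field A" for a u v w
    using B that unfolding order_on_defs by (meson transD)
  have antisymB: "u = v" if "(u, v) \<in> B a" "(v, u) \<in> B a" "a \<in> Field A" for a u v
    using B that unfolding order_on_defs by (meson antisymD)
  have "refl_on (Field (indexed_sum A B)) (indexed_sum A B)"
  proof (rule refl_onI)
    fix x assume "x \<in> Field (indexed_sum A B)"
    then obtain a u where "x = a # u" "a \<in> Field A" "u \<in> Field (B a)"
      unfolding F by blast
    then show "(x, x) \<in> indexed_sum A B"
      using Linear_order_refl[OF B] unfolding indexed_sum_def by simp
  qed
  moreover have "trans (indexed_sum A B)"
  proof (rule transI)
    fix x y z assume "(x, y) \<in> indexed_sum A B" "(y, z) \<in> indexed_sum A B"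
    then show "(x, z) \<in> indexed_sum A B"
      using Linear_order_strict_trans[OF A] unfolding indexed_sum_def
      by (auto dest: transB)
  qed
  moreover have "antisym (indexed_sum A B)"
  proof (rule antisymI)
    fix x y assume "(x, y) \<in> indexed_sum A B" "(y, x) \<in> indexed_sum A B"
    then show "x = y"
      using Linear_order_strict_asym[OF A] unfolding indexed_sum_def
      by (auto simp: strict_def dest: antisymB)
  qed
  moreover have "total_on (Field (indexed_sum A B)) (indexed_sum A B)"
    unfolding total_on_def
  proof (intro ballI impI)
    fix x y assume "x \<in> Field (indexed_sum A B)" "y \<in> Field (indexed_sum A B)" "x \<noteq> y"
    then obtain a u b v where "a \<in> Field A" "u \<in> Field (B a)" "b \<in> Field A" "v \<in> Field (B b)"
      "x = a # u" "y = b # v" "a \<noteq> b \<or> u \<noteq> v"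
      unfolding F by blast
    then show "(x, y) \<in> indexed_sum A B \<or> (y, x) \<in> indexed_sum A B"
      using Linear_order_strict_total[OF A, of a b] Linear_order_strict_total[OF B, of a u v]
      unfolding indexed_sum_def strict_def by auto
  qed
  ultimately show ?thesis
    unfolding order_on_defs by (auto intro: FieldI1 FieldI2)
qed

lemma Linear_order_signed_omega: "Linear_order (signed_omega s)"
  using natLeq_Linear_order by (cases s) auto

lemma Field_signed_omega: "Field (signed_omega s) = UNIV"
  by (cases s) (auto simp: Field_natLeq)

lemma Linear_order_natLeq_on: "Linear_order (natLeq_on n)"
  using natLeq_on_Well_order unfolding well_order_on_def by blast

lemma Linear_order_order_one: "Linear_order order_one"
  unfolding order_one_def order_on_defs by (auto simp: refl_on_def Field_def trans_def antisym_def)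

lemma Field_order_one: "Field order_one = {[]}"
  by (auto simp: order_one_def Field_def)

definition children_sum :: "stree list \<Rightarrow> nat list rel" where
  "children_sum ts = (if ts = [] then order_one
      else indexed_sum (natLeq_on (length ts)) (\<lambda>x. map tree_order ts ! x))"

lemma tree_order_eq: "tree_order (Node s ts) = indexed_sum (signed_omega s) (\<lambda>_. children_sum ts)"
  by (simp add: children_sum_def lex_product_def)

declare tree_order.simps [simp del]

text \<open>Linearity of the children is a hypothesis because this serves as the inductive step of
  \<open>Linear_order_tree_order\<close>.\<close>

lemma Linear_order_children_sum_aux:
  assumes "\<And>t. t \<in> set ts \<Longrightarrow> Linear_order (tree_order t)"
  shows "Linear_order (children_sum ts)"
proof (cases "ts = []")
  case True
  then show ?thesis
    unfolding children_sum_def using Linear_order_order_one by presburger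
next
  case False
  have "Linear_order (indexed_sum (natLeq_on (length ts)) (\<lambda>x. map tree_order ts ! x))"
  proof (rule Linear_order_indexed_sum[OF Linear_order_natLeq_on])
    fix a assume "a \<in> Field (natLeq_on (length ts))"
    then have "a < length ts"
      unfolding Field_natLeq_on by simp
    then show "Linear_order (map tree_order ts ! a)"
      unfolding nth_map[OF \<open>a < length ts\<close>] by (intro assms nth_mem)
  qed
  then show ?thesis
    using False by (simp only: children_sum_def if_False)
qed

lemma Linear_order_tree_order: "Linear_order (tree_order t)"
proof (induction t)
  case (Node s ts)
  then show ?case
    unfolding tree_order_eq
    by (intro Linear_order_indexed_sum Linear_order_signed_omega Linear_order_children_sum_aux)
qed

lemma Linear_order_children_sum: "Linear_order (children_sum ts)"
  by (intro Linear_order_children_sum_aux Linear_order_tree_order)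

text \<open>These are the blocks of the order of \<open>Node s ts\<close>: they exhaust it
  (\<open>Field_tree_order\<close>) and form a sequence of sign \<open>s\<close>
  (\<open>block_seq_copy\<close>).\<close>

definition copy :: "stree list \<Rightarrow> nat \<Rightarrow> nat list set" where
  "copy ts k = (\<lambda>u. k # u) ` Field (children_sum ts)"

lemma Field_tree_order: "Field (tree_order (Node s ts)) = (\<Union>k. copy ts k)"
proof -
  have "Field (tree_order (Node s ts)) =
      {a # u | a u. a \<in> Field (signed_omega s) \<and> u \<in> Field (children_sum ts)}"
    unfolding tree_order_eq
    by (rule Field_indexed_sum[OF Linear_order_signed_omega Linear_order_children_sum])
  then show ?thesis
    unfolding copy_def Field_signed_omega by blast
qed

lemma strict_signed_omega: "strict (directed s (signed_omega s)) j k \<longleftrightarrow> j < k"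
  by (cases s) (auto simp: strict_def natLeq_def)

lemma strict_tree_order:
  "strict (tree_order (Node s ts)) (j # u) (k # v) \<longleftrightarrow>
     u \<in> Field (children_sum ts) \<and> v \<in> Field (children_sum ts) \<and>
     (strict (signed_omega s) j k \<or> j = k \<and> strict (children_sum ts) u v)"
  unfolding tree_order_eq strict_indexed_sum Field_signed_omega by simp

lemma block_seq_copy: "block_seq s (tree_order (Node s ts)) (copy ts)"
proof (cases s)
  case Plus
  then show ?thesis
    unfolding block_seq_def before_def copy_def using strict_signed_omega[of s]
    by (auto simp: strict_tree_order)
next
  case Minus
  then show ?thesis
    unfolding block_seq_def before_def copy_def using strict_signed_omega[of s]
    by (auto simp: strict_tree_order)
qed

lemma emb_copy:
  "emb (children_sum ts) (Field (children_sum ts)) (tree_order (Node s ts)) (copy ts k)"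
  by (rule embI[of _ "\<lambda>u. k # u"]) (auto simp: strict_tree_order copy_def)

lemma copy_emb:
  "emb (tree_order (Node s ts)) (copy ts k) (children_sum ts) (Field (children_sum ts))"
  by (rule embI[of _ tl]) (auto simp: strict_tree_order copy_def strict_def[of "signed_omega s"])

definition child_copy :: "stree list \<Rightarrow> nat \<Rightarrow> nat list set" where
  "child_copy ts x = (\<lambda>u. x # u) ` Field (tree_order (ts ! x))"

lemma children_sum_nonempty:
  assumes "ts \<noteq> []"
  shows "Field (children_sum ts) = (\<Union>x < length ts. child_copy ts x)" (is ?F)
    and "x < length ts \<Longrightarrow> y < length ts \<Longrightarrow> strict (children_sum ts) (x # u) (y # v) \<longleftrightarrow>
      u \<in> Field (tree_order (ts ! x)) \<and> v \<in> Field (tree_order (ts ! y)) \<and>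
      (x < y \<or> x = y \<and> strict (tree_order (ts ! x)) u v)" (is "_ \<Longrightarrow> _ \<Longrightarrow> ?S")
proof -
  define N where "N = natLeq_on (length ts)"
  have FN: "Field N = {x. x < length ts}"
    unfolding N_def by (rule Field_natLeq_on)
  have eq: "children_sum ts = indexed_sum N (\<lambda>x. tree_order (ts ! x))"
    using assms unfolding children_sum_def N_def[symmetric]
    by (auto simp: FN intro!: indexed_sum_cong)
  have "Linear_order N"
    unfolding N_def by (rule Linear_order_natLeq_on)
  then show ?F
    unfolding eq child_copy_def
    by (subst Field_indexed_sum[OF _ Linear_order_tree_order]) (auto simp: FN)
  show ?S if "x < length ts" "y < length ts"
    unfolding eq strict_indexed_sum FN using that by (auto simp: N_def strict_def[of "natLeq_on _"])
qed

lemma emb_child_copy: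
  assumes "x < length ts"
  shows "emb (tree_order (ts ! x)) (Field (tree_order (ts ! x))) (children_sum ts) (child_copy ts x)"
proof -
  have "ts \<noteq> []"
    using assms by auto
  then show ?thesis
    using assms by (intro embI[of _ "\<lambda>u. x # u"]) (auto simp: children_sum_nonempty child_copy_def)
qed

lemma child_copy_emb:
  assumes "x < length ts"
  shows "emb (children_sum ts) (child_copy ts x) (tree_order (ts ! x)) (Field (tree_order (ts ! x)))"
proof -
  have "ts \<noteq> []"
    using assms by auto
  then show ?thesis
    using assms by (intro embI[of _ tl]) (auto simp: children_sum_nonempty child_copy_def)
qed

lemma before_child_copy:
  assumes "x < y" "y < length ts"
  shows "before (children_sum ts) (child_copy ts x) (child_copy ts y)"
proof -
  have "ts \<noteq> []"
    using assms by auto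
  then show ?thesis
    using assms by (auto simp: children_sum_nonempty child_copy_def before_def)
qed

text \<open>Each child embeds into every copy, hence into infinitely many blocks; this is what makes
  its order absorbed by the parent.\<close>

lemma emb_child:
  assumes "t \<in> set ts"
  shows "emb (tree_order t) (Field (tree_order t)) (tree_order (Node s ts)) (copy ts k)"
proof -
  obtain x where x: "x < length ts" "t = ts ! x"
    using assms by (metis in_set_conv_nth)
  moreover have "ts \<noteq> []"
    using x by auto
  ultimately have "child_copy ts x \<subseteq> Field (children_sum ts)"
    by (auto simp: children_sum_nonempty(1))
  then have "emb (tree_order t) (Field (tree_order t)) (children_sum ts) (Field (children_sum ts))"
    using emb_mono[OF emb_child_copy order_refl] x by blast
  then show ?thesis
    using emb_copy by (rule emb_trans)
qed

text \<open>Absorbed sets are closed under finite sums, so the children are added one at a time. The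
  arrangement and multiplicity of the children do not enter, only the set of them.\<close>

lemma absorbed_children_sum:
  assumes "block_seq s S B" "ts \<noteq> []"
    and "\<And>t. t \<in> set ts \<Longrightarrow> absorbed (tree_order t) (Field (tree_order t)) S B"
  shows "absorbed (children_sum ts) (Field (children_sum ts)) S B"
proof -
  have "absorbed (children_sum ts) (\<Union>x < n. child_copy ts x) S B" if "n \<le> length ts" for n
    using that
  proof (induction n)
    case 0
    then show ?case by (simp add: absorbed_empty)
  next
    case (Suc n)
    have "absorbed (children_sum ts) ((\<Union>x < n. child_copy ts x) \<union> child_copy ts n) S B"
    proof (rule absorbed_Un[OF Linear_order_children_sum _ assms(1)])
      show "before (children_sum ts) (\<Union>x < n. child_copy ts x) (child_copy ts n)"
        using before_child_copy[of _ n ts] Suc.prems unfolding before_def by auto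
      show "absorbed (children_sum ts) (child_copy ts n) S B"
        using absorbed_trans[OF child_copy_emb assms(3)] Suc.prems by auto
    qed (use Suc in auto)
    then show ?case
      by (simp add: lessThan_Suc Un_commute)
  qed
  from this[of "length ts"] show ?thesis
    using assms(2) by (simp add: children_sum_nonempty(1))
qed

section \<open>Nodes of a tree and the order \<open>LIN\<close>\<close>

fun subtree :: "stree \<Rightarrow> nat list \<Rightarrow> stree option" where
  "subtree t [] = Some t"
| "subtree (Node s ts) (x # \<sigma>) = (if x < length ts then subtree (ts ! x) \<sigma> else None)"

lemma subtree_append:
  "subtree t (\<sigma> @ \<tau>) = (case subtree t \<sigma> of None \<Rightarrow> None | Some u \<Rightarrow> subtree u \<tau>)"
  by (induction t \<sigma> rule: subtree.induct) auto

definition nodes :: "stree \<Rightarrow> nat list set" where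
  "nodes t = {\<sigma>. subtree t \<sigma> \<noteq> None}"

definition node_sign :: "stree \<Rightarrow> nat list \<Rightarrow> sign" where
  "node_sign t \<sigma> = root_sign (the (subtree t \<sigma>))"

lemma finite_nodes: "finite (nodes t)"
proof (induction t)
  case (Node s ts)
  have "nodes (Node s ts) \<subseteq> insert [] (\<Union>x < length ts. (#) x ` nodes (ts ! x))"
  proof
    fix \<sigma> assume "\<sigma> \<in> nodes (Node s ts)"
    then show "\<sigma> \<in> insert [] (\<Union>x < length ts. (#) x ` nodes (ts ! x))"
      by (cases \<sigma>) (auto simp: nodes_def split: if_splits)
  qed
  moreover have "finite (\<Union>x < length ts. (#) x ` nodes (ts ! x))"
    using Node by simp
  ultimately show ?case
    using finite_subset by blast
qed

lemma finite_tree_nodes: "finite_tree (nodes t)"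
proof -
  have "[] \<in> nodes t"
    by (simp add: nodes_def)
  moreover have "\<tau> \<in> nodes t" if "\<sigma> \<in> nodes t" "prefix \<tau> \<sigma>" for \<sigma> \<tau>
    using that by (auto simp: nodes_def prefix_def subtree_append split: option.splits)
  ultimately show ?thesis
    unfolding finite_tree_def using finite_nodes by blast
qed

lemma child_in_nodes_iff:
  "subtree t \<sigma> = Some (Node s ts) \<Longrightarrow> \<sigma> @ [x] \<in> nodes t \<longleftrightarrow> x < length ts"
  by (simp add: nodes_def subtree_append)

lemma num_children_nodes:
  "subtree t \<sigma> = Some (Node s ts) \<Longrightarrow> num_children (nodes t) \<sigma> = length ts"
  by (simp add: num_children_def child_in_nodes_iff)

lemma standard_labelling_nodes: "standard_labelling (nodes t)"
  unfolding standard_labelling_def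
proof (intro ballI allI)
  fix \<sigma> x assume "\<sigma> \<in> nodes t"
  then obtain s ts where "subtree t \<sigma> = Some (Node s ts)"
    unfolding nodes_def by (metis (mono_tags) mem_Collect_eq option.exhaust stree.exhaust)
  then show "\<sigma> @ [x] \<in> nodes t \<longleftrightarrow> x < num_children (nodes t) \<sigma>"
    by (simp only: child_in_nodes_iff num_children_nodes)
qed

text \<open>The recursion of \<open>LIN\<close> keeps the whole tree and moves the node. The
  induction therefore runs over the subtree found at an arbitrary node \<sigma>.\<close>

lemma LIN_nodes:
  "subtree t \<sigma> = Some u \<Longrightarrow> LIN (nodes t) (node_sign t) \<sigma> = tree_order u"
proof (induction u arbitrary: \<sigma>)
  case (Node s ts)
  have "node_sign t \<sigma> = s"
    by (simp add: node_sign_def Node.prems)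
  moreover have "\<sigma> \<in> nodes t"
    by (simp add: nodes_def Node.prems)
  moreover have "indexed_sum (natLeq_on (length ts)) (\<lambda>x. LIN (nodes t) (node_sign t) (\<sigma> @ [x])) =
      indexed_sum (natLeq_on (length ts)) (\<lambda>x. map tree_order ts ! x)"
  proof (rule indexed_sum_cong[OF refl])
    fix x assume "x \<in> Field (natLeq_on (length ts))"
    then have x: "x < length ts"
      unfolding Field_natLeq_on by simp
    then have "subtree t (\<sigma> @ [x]) = Some (ts ! x)"
      by (simp add: subtree_append Node.prems)
    then show "LIN (nodes t) (node_sign t) (\<sigma> @ [x]) = map tree_order ts ! x"
      using Node.IH x by simp
  qed
  ultimately show ?case
    by (subst LIN.simps)
      (simp only: finite_nodes num_children_nodes[OF Node.prems]
        tree_order.simps length_0_conv simp_thms if_True)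
qed

section \<open>Alternating trees and the finite sets of trees needed at each rank\<close>

fun balanced :: "stree list \<Rightarrow> bool" where
  "balanced [] \<longleftrightarrow> True"
| "balanced [t] \<longleftrightarrow> False"
| "balanced (t # u # ts) \<longleftrightarrow> root_sign t = Plus \<and> root_sign u = Minus \<and> balanced ts"

inductive alternating_tree :: "stree \<Rightarrow> bool" where
  "balanced ts \<Longrightarrow> (\<And>t. t \<in> set ts \<Longrightarrow> alternating_tree t) \<Longrightarrow> alternating_tree (Node s ts)"

lemma balanced_even: "balanced ts \<Longrightarrow> even (length ts)"
  by (induction ts rule: balanced.induct) auto

lemma balanced_nth:
  "balanced ts \<Longrightarrow> x < length ts \<Longrightarrow> root_sign (ts ! x) = (if even x then Plus else Minus)"
proof (induction ts arbitrary: x rule: balanced.induct)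
  case (3 t u ts)
  show ?case
  proof (cases x)
    case (Suc y)
    then show ?thesis
      using 3 by (cases y) auto
  qed (use 3 in auto)
qed auto

lemma alternating_tree_subtree:
  "subtree t \<sigma> = Some u \<Longrightarrow> alternating_tree t \<Longrightarrow> alternating_tree u"
  by (induction t \<sigma> rule: subtree.induct) (auto split: if_splits elim: alternating_tree.cases)

lemma alternating_nodes:
  assumes "alternating_tree t"
  shows "alternating (nodes t) (node_sign t)"
  unfolding alternating_def
proof
  fix \<sigma> assume "\<sigma> \<in> nodes t"
  then obtain s ts where sub: "subtree t \<sigma> = Some (Node s ts)"
    unfolding nodes_def by (metis (mono_tags) mem_Collect_eq option.exhaust stree.exhaust)
  then have bal: "balanced ts"
    using alternating_tree_subtree[OF sub assms] by (auto elim: alternating_tree.cases)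
  have "node_sign t (\<sigma> @ [x]) = (if even x then Plus else Minus)" if "x < length ts" for x
    using that balanced_nth[OF bal that] by (simp add: node_sign_def subtree_append sub)
  then show "even (num_children (nodes t) \<sigma>) \<and> (\<forall>x < num_children (nodes t) \<sigma>.
      node_sign t (\<sigma> @ [x]) = (if even x then Plus else Minus))"
    using balanced_even[OF bal] by (simp add: num_children_nodes[OF sub])
qed

text \<open>The final two leaves make the set of trees in the result uniform, see \<open>set_interleave\<close>.\<close>

fun interleave :: "stree list \<Rightarrow> stree list" where
  "interleave [] = [leaf Plus, leaf Minus]"
| "interleave (t # ts) =
     (if root_sign t = Plus then [t, leaf Minus] else [leaf Plus, t]) @ interleave ts"

lemma balanced_interleave: "balanced (interleave ts)"
  by (induction ts) (use sign.exhaust in \<open>auto\<close>)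

lemma set_interleave: "set (interleave ts) = {leaf Plus, leaf Minus} \<union> set ts"
  by (induction ts) auto

lemma interleave_nonempty: "interleave ts \<noteq> []"
  by (cases ts) auto

lemma alternating_leaf: "alternating_tree (leaf s)"
  by (intro alternating_tree.intros) auto

lemma alternating_interleave:
  "(\<And>t. t \<in> set ts \<Longrightarrow> alternating_tree t) \<Longrightarrow> alternating_tree (Node s (interleave ts))"
  by (intro alternating_tree.intros balanced_interleave)
    (auto simp: set_interleave alternating_leaf)

text \<open>A fixed enumeration gives one tree for each set of children, so that finitely many sets
  yield finitely many trees.\<close>

definition list_of :: "'a set \<Rightarrow> 'a list" where
  "list_of G = (SOME ts. set ts = G)"

lemma set_list_of: "finite G \<Longrightarrow> set (list_of G) = G"
  unfolding list_of_def by (rule someI_ex) (rule finite_list)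

text \<open>These are the trees that one step up in rank can require: the old ones for the initial
  blocks of a sequence, the leaves for tails made of finite blocks, and one tree for each sign and
  each set \<open>G\<close> of trees that recur along a sequence.\<close>

definition enlarge :: "stree set \<Rightarrow> stree set" where
  "enlarge F = F \<union> range leaf \<union> (\<lambda>(s, G). Node s (interleave (list_of G))) ` (UNIV \<times> Pow F)"

lemma subset_enlarge: "F \<subseteq> enlarge F"
  unfolding enlarge_def by blast

lemma finite_UNIV_sign: "finite (UNIV :: sign set)"
proof -
  have "(UNIV :: sign set) \<subseteq> {Plus, Minus}"
    using sign.exhaust by auto
  then show ?thesis
    using finite_subset by blast
qed

lemma finite_enlarge: "finite F \<Longrightarrow> finite (enlarge F)"
  unfolding enlarge_def using finite_UNIV_sign by simp

lemma alternating_enlarge: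
  assumes "finite F" "\<And>t. t \<in> F \<Longrightarrow> alternating_tree t" "t \<in> enlarge F"
  shows "alternating_tree t"
proof -
  consider "t \<in> F" | s where "t = leaf s"
    | s G where "G \<subseteq> F" "t = Node s (interleave (list_of G))"
    using assms(3) unfolding enlarge_def by auto
  then show ?thesis
  proof cases
    case 3
    then have "set (list_of G) \<subseteq> F"
      using set_list_of finite_subset[OF _ assms(1)] by blast
    then show ?thesis
      unfolding 3 using assms(2) by (intro alternating_interleave) blast
  qed (use assms alternating_leaf in auto)
qed

section \<open>Finite decompositions into tree orders\<close>

text \<open>A piece need only be equimorphic to a tree order, since that is all that can be said
  about the tail of a sequence. The sums are formed inside \<open>L\<close>, so every summand is an
  actual subset.\<close>

inductive pieces :: "'a rel \<Rightarrow> stree set \<Rightarrow> 'a set \<Rightarrow> bool" for L F where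
  empty: "pieces L F {}"
| point: "x \<in> Field L \<Longrightarrow> pieces L F {x}"
| tree: "t \<in> F \<Longrightarrow> X \<subseteq> Field L \<Longrightarrow> emb L X (tree_order t) (Field (tree_order t)) \<Longrightarrow>
    emb (tree_order t) (Field (tree_order t)) L X \<Longrightarrow> pieces L F X"
| join: "pieces L F X \<Longrightarrow> pieces L F Y \<Longrightarrow> before L X Y \<Longrightarrow> pieces L F (X \<union> Y)"

lemma pieces_subset_Field: "pieces L F X \<Longrightarrow> X \<subseteq> Field L"
  by (induction rule: pieces.induct) auto

lemma pieces_mono: "pieces L F X \<Longrightarrow> F \<subseteq> G \<Longrightarrow> pieces L G X"
  by (induction rule: pieces.induct) (auto intro: pieces.intros)

lemma pieces_embedded_trees:
  "pieces L F X \<Longrightarrow> X \<subseteq> Z \<Longrightarrow> pieces L {t \<in> F. emb (tree_order t) (Field (tree_order t)) L Z} X"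
  by (induction rule: pieces.induct) (auto intro: pieces.intros emb_mono)

lemma pieces_join_directed:
  "pieces L F X \<Longrightarrow> pieces L F Y \<Longrightarrow> before (directed s L) X Y \<Longrightarrow> pieces L F (X \<union> Y)"
proof (cases s)
  case Minus
  assume *: "pieces L F X" "pieces L F Y" "before (directed s L) X Y"
  then have "pieces L F (Y \<union> X)"
    using Minus by (intro pieces.join) (auto simp: before_def)
  then show ?thesis
    by (simp add: Un_commute)
qed (auto intro: pieces.join)

lemma pieces_UN_lessThan:
  assumes "block_seq s L X" "\<And>k. pieces L F (X k)"
  shows "pieces L F (\<Union>k < n. X k)"
proof (induction n)
  case 0
  then show ?case by (simp add: pieces.empty)
next
  case (Suc n)
  have "before (directed s L) (\<Union>k < n. X k) (X n)"
    using assms(1) unfolding block_seq_def before_def by auto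
  from pieces_join_directed[OF Suc assms(2) this] show ?case
    by (simp add: lessThan_Suc Un_commute)
qed

lemma finite_has_last:
  assumes "Linear_order L" "finite X" "X \<noteq> {}" "X \<subseteq> Field L"
  shows "\<exists>m \<in> X. \<forall>x \<in> X. (x, m) \<in> L"
  using assms(2-4)
proof (induction X rule: finite_ne_induct)
  case (singleton x)
  then show ?case using Linear_order_refl[OF assms(1)] by auto
next
  case (insert x X)
  from insert.prems have "X \<subseteq> Field L"
    by blast
  then obtain m where m: "m \<in> X" "\<forall>x \<in> X. (x, m) \<in> L"
    using insert.IH by blast
  have F: "x \<in> Field L" "m \<in> Field L"
    using insert m by auto
  have tr: "trans L"
    using assms(1) by (simp add: order_on_defs)
  show ?case
  proof (cases "(x, m) \<in> L")
    case True
    then show ?thesis using m by auto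
  next
    case False
    then have "(m, x) \<in> L"
      using F Linear_order_not_strict[OF assms(1), of x m] by (auto simp: strict_def)
    then have "\<forall>y \<in> insert x X. (y, x) \<in> L"
      using m(2) tr Linear_order_refl[OF assms(1) F(1)] by (auto dest: transD)
    then show ?thesis by blast
  qed
qed

lemma pieces_finite:
  assumes "Linear_order L"
  shows "finite X \<Longrightarrow> X \<subseteq> Field L \<Longrightarrow> pieces L F X"
proof (induction "card X" arbitrary: X)
  case 0
  then show ?case by (simp add: pieces.empty)
next
  case (Suc n)
  from Suc.hyps(2) have "X \<noteq> {}" by auto
  then obtain m where m: "m \<in> X" "\<forall>x \<in> X. (x, m) \<in> L"
    using finite_has_last[OF assms Suc.prems(1) _ Suc.prems(2)] by blast
  have "n = card (X - {m})"
    using Suc.hyps(2) m(1) Suc.prems(1) by simp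
  moreover have "finite (X - {m})" "X - {m} \<subseteq> Field L"
    using Suc.prems by auto
  ultimately have "pieces L F (X - {m})"
    by (rule Suc.hyps(1))
  moreover have "before L (X - {m}) {m}"
    using m unfolding before_def strict_def by auto
  moreover have "m \<in> Field L"
    using m(1) Suc.prems(2) by blast
  ultimately have "pieces L F ((X - {m}) \<union> {m})"
    by (intro pieces.join pieces.point)
  moreover have "(X - {m}) \<union> {m} = X"
    using m by auto
  ultimately show ?case by simp
qed

lemma absorbed_point:
  assumes "\<And>k. B k \<noteq> {}"
  shows "absorbed R {x} S B"
proof (rule absorbed_infinitely_often)
  fix k
  obtain b where "b \<in> B k"
    using assms by blast
  then have "emb R {x} S (B k)"
    by (intro embI[of _ "\<lambda>_. b"]) (auto simp: strict_def)
  then show "\<exists>j \<ge> k. emb R {x} S (B j)"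
    by blast
qed

text \<open>Absorption passes through every rule that builds a decomposition; the nonempty blocks
  provide for the points.\<close>

lemma pieces_absorbed:
  assumes L: "Linear_order L" and B: "block_seq s S B" "\<And>k. B k \<noteq> {}"
    and F: "\<And>t. t \<in> F \<Longrightarrow> absorbed (tree_order t) (Field (tree_order t)) S B"
  shows "pieces L F X \<Longrightarrow> absorbed L X S B"
proof (induction rule: pieces.induct)
  case empty
  then show ?case by (rule absorbed_empty)
next
  case (point x)
  then show ?case by (intro absorbed_point B)
next
  case (tree t X)
  then show ?case using absorbed_trans F by blast
next
  case (join X Y)
  then show ?case using absorbed_Un[OF L _ B(1)] by blast
qed

text \<open>Two sequences of the same sign, each absorbing the blocks of the other, have equimorphic
  unions. One of them here consists of the copies of the sum of the children.\<close>

lemma UN_emb_Node: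
  assumes L: "Linear_order L" and X: "block_seq s L X"
    and abs: "\<And>k. absorbed L (X k) (tree_order (Node s ts)) (copy ts)"
    and abs': "absorbed (children_sum ts) (Field (children_sum ts)) L X"
  shows "emb L (\<Union>k. X k) (tree_order (Node s ts)) (Field (tree_order (Node s ts)))"
    and "emb (tree_order (Node s ts)) (Field (tree_order (Node s ts))) L (\<Union>k. X k)"
proof -
  show "emb L (\<Union>k. X k) (tree_order (Node s ts)) (Field (tree_order (Node s ts)))"
    unfolding Field_tree_order by (rule emb_UN_absorbed[OF L X block_seq_copy abs])
  show "emb (tree_order (Node s ts)) (Field (tree_order (Node s ts))) L (\<Union>k. X k)"
    unfolding Field_tree_order
    by (rule emb_UN_absorbed[OF Linear_order_tree_order block_seq_copy X])
      (rule absorbed_trans[OF copy_emb abs'])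
qed

lemma absorbed_shift:
  assumes "absorbed R A S B"
  shows "absorbed R A S (\<lambda>k. B (k + N))"
  unfolding absorbed_def
proof
  fix k
  obtain l where l: "k + N \<le> l" "emb R A S (\<Union>j \<in> {k + N..<l}. B j)"
    using assms unfolding absorbed_def by blast
  have "B j \<subseteq> (\<Union>j \<in> {k..<l - N}. B (j + N))" if "j \<in> {k + N..<l}" for j
    using that by (intro order_trans[OF _ UN_upper[of "j - N"]]) auto
  then have "(\<Union>j \<in> {k + N..<l}. B j) \<subseteq> (\<Union>j \<in> {k..<l - N}. B (j + N))"
    by blast
  then have "emb R A S (\<Union>j \<in> {k..<l - N}. B (j + N))"
    using emb_mono[OF l(2) order_refl] by blast
  moreover have "k \<le> l - N"
    using l(1) by simp
  ultimately show "\<exists>l \<ge> k. emb R A S (\<Union>j \<in> {k..<l}. B (j + N))"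
    by blast
qed

lemma block_seq_shift: "block_seq s S B \<Longrightarrow> block_seq s S (\<lambda>k. B (k + N))"
  unfolding block_seq_def by auto

lemma UN_split: "(\<Union>k. X k) = (\<Union>k < N. X k) \<union> (\<Union>k. X (k + N :: nat))"
proof -
  have "X k \<subseteq> (\<Union>k < N. X k) \<union> (\<Union>k. X (k + N))" for k
  proof (cases "k < N")
    case False
    then have "X k = X ((k - N) + N)"
      by simp
    then show ?thesis by blast
  qed auto
  then show ?thesis by blast
qed

lemma before_UN_split:
  assumes "block_seq s L X"
  shows "before (directed s L) (\<Union>k < N. X k) (\<Union>k. X (k + N))"
proof -
  have "before (directed s L) (X j) (X (k + N))" if "j < N" for j k
    using assms that unfolding block_seq_def by simp
  then show ?thesis
    unfolding before_def by blast
qed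

lemma copy_nonempty: "copy ts k \<noteq> {}"
proof (cases "ts = []")
  case True
  then show ?thesis
    by (simp add: copy_def children_sum_def Field_order_one)
next
  case False
  have "Field (tree_order t) \<noteq> {}" for t
  proof (induction t)
    case (Node s us)
    have "Field (children_sum us) \<noteq> {}"
    proof (cases "us = []")
      case False
      then show ?thesis
        using Node[of "us ! 0"] by (auto simp: children_sum_nonempty(1) child_copy_def)
    qed (simp add: children_sum_def Field_order_one)
    then show ?case
      by (auto simp: Field_tree_order copy_def)
  qed
  then show ?thesis
    using False by (auto simp: copy_def children_sum_nonempty(1) child_copy_def)
qed

text \<open>Trees of \<open>F\<close> that embed into only finitely many blocks disappear after an
  initial part. The tail is then equimorphic to a single node whose children are the recurring trees
  together with leaves of both signs, and the initial part is a finite sum of blocks already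
  decomposed.\<close>

lemma pieces_block_sequence:
  assumes L: "Linear_order L" and F: "finite F" and X: "block_seq s L X"
    and pc: "\<And>k. pieces L F (X k)"
    and leaves: "\<And>s'. absorbed (tree_order (leaf s')) (Field (tree_order (leaf s'))) L X"
  shows "pieces L (enlarge F) (\<Union>k. X k)"
proof -
  define below where "below t k \<longleftrightarrow> emb (tree_order t) (Field (tree_order t)) L (X k)" for t k
  define G where "G = {t \<in> F. \<forall>N. \<exists>k \<ge> N. below t k}"
  define ts where "ts = interleave (list_of G)"
  have "finite G" "G \<subseteq> F"
    using F unfolding G_def by auto
  then have set_ts: "set ts = {leaf Plus, leaf Minus} \<union> G"
    unfolding ts_def by (simp add: set_interleave set_list_of)
  have "\<forall>t \<in> F - G. \<exists>N. \<forall>k \<ge> N. \<not> below t k"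
    unfolding G_def by blast
  then obtain N where N: "\<And>t k. t \<in> F - G \<Longrightarrow> N t \<le> k \<Longrightarrow> \<not> below t k"
    by metis
  \<comment> \<open>A common bound past which no tree of \<open>F\<close> outside \<open>G\<close>
    embeds into a block. The inserted 0 covers the case of an empty \<open>F\<close>.\<close>
  define M where "M = Max (insert 0 (N ` F))"
  have M: "N t \<le> M" if "t \<in> F" for t
    unfolding M_def using F that by simp
  define Y where "Y k = X (k + M)" for k
  \<comment> \<open>A tree occurring in a block of the tail embeds into that block, and so belongs
    to \<open>G\<close> by the choice of \<open>M\<close>.\<close>
  have pcY: "pieces L G (Y k)" for k
  proof -
    have "{t \<in> F. below t (k + M)} \<subseteq> G"
      using N M trans_le_add2 by blast
    then show ?thesis
      unfolding Y_def using pieces_embedded_trees[OF pc order_refl] pieces_mono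
      unfolding below_def by blast
  qed
  have Y: "block_seq s L Y"
    unfolding Y_def by (rule block_seq_shift[OF X])
  have "absorbed (tree_order t) (Field (tree_order t)) L Y" if "t \<in> set ts" for t
  proof (cases "t \<in> G")
    case True
    show ?thesis
    proof (rule absorbed_infinitely_often)
      fix k
      obtain j where "j \<ge> k + M" "below t j"
        using True unfolding G_def by blast
      then show "\<exists>j \<ge> k. emb (tree_order t) (Field (tree_order t)) L (Y j)"
        unfolding Y_def below_def by (intro exI[of _ "j - M"]) simp
    qed
  next
    \<comment> \<open>The remaining children are leaves inserted to balance the signs; they are
      absorbed by the hypothesis \<open>leaves\<close>.\<close>
    case False
    then obtain s' where "t = leaf s'"
      using \<open>t \<in> set ts\<close> set_ts by blast
    then show ?thesis
      unfolding Y_def using absorbed_shift[OF leaves] by simp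
  qed
  then have abs: "absorbed (children_sum ts) (Field (children_sum ts)) L Y"
    using absorbed_children_sum[OF Y] interleave_nonempty unfolding ts_def by blast
  \<comment> \<open>Conversely, each block of the tail is a sum of points and trees from
    \<open>G\<close>, and every such tree is a child and thus embeds into every copy.\<close>
  have abs': "absorbed L (Y k) (tree_order (Node s ts)) (copy ts)" for k
  proof (rule pieces_absorbed[OF L block_seq_copy copy_nonempty _ pcY])
    fix t assume "t \<in> G"
    then have "t \<in> set ts"
      using set_ts by blast
    then show "absorbed (tree_order t) (Field (tree_order t)) (tree_order (Node s ts)) (copy ts)"
      by (intro absorbed_infinitely_often) (blast intro: emb_child)
  qed
  have "pieces L (enlarge F) (\<Union>k. Y k)"
  proof (rule pieces.tree)
    show "Node s ts \<in> enlarge F"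
      using \<open>G \<subseteq> F\<close> unfolding enlarge_def ts_def
      by (intro UnI2 image_eqI[of _ _ "(s, G)"]) auto
    show "(\<Union>k. Y k) \<subseteq> Field L"
      using pieces_subset_Field[OF pcY] by blast
  qed (rule UN_emb_Node[OF L Y abs' abs])+
  moreover have "pieces L (enlarge F) (\<Union>k < M. X k)"
    by (rule pieces_mono[OF pieces_UN_lessThan[OF X pc] subset_enlarge])
  ultimately show ?thesis
    using pieces_join_directed[OF _ _ before_UN_split[OF X, of M]] UN_split[of X M]
    unfolding Y_def by metis
qed

section \<open>Discrete orders\<close>

lemma discrete_order_directed: "discrete_order (directed s L) \<longleftrightarrow> discrete_order L"
proof -
  have "immediate_succ (L\<inverse>) x y \<longleftrightarrow> immediate_succ L y x" for x y
    unfolding immediate_succ_def by auto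
  then show ?thesis
    by (cases s) (simp_all only: directed_simps discrete_order_def Field_converse converse_iff conj_commute)
qed

text \<open>Starting at \<open>a\<close>, pass repeatedly to the immediate successor. Each step
  removes a single point from the interval below \<open>b\<close>, which therefore stays infinite,
  and the process never stops.\<close>

lemma successor_chain:
  assumes L: "Linear_order L" "discrete_order L" and inf: "infinite {z. strict L a z \<and> strict L z b}"
  shows "\<exists>g :: nat \<Rightarrow> 'a. \<forall>n. strict L a (g n) \<and> strict L (g n) b \<and> strict L (g n) (g (Suc n))"
proof -
  define I where "I x = {z. strict L x z \<and> strict L z b}" for x
  have step: "\<exists>y. strict L x y \<and> strict L y b \<and> infinite (I y)"
    if x: "infinite (I x)" for x
  proof -
    have "I x \<noteq> {}"
      using x by auto
    then obtain z where "strict L x z" "strict L z b"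
      unfolding I_def by blast
    then have xb: "strict L x b" "x \<in> Field L" "b \<in> Field L"
      using Linear_order_strict_trans[OF L(1)] strict_Field by metis+
    then have "\<not> (\<forall>y \<in> Field L. (y, x) \<in> L)"
      using Linear_order_not_strict[OF L(1)] by blast
    then obtain y where y: "immediate_succ L x y"
      using L(2) xb(2) unfolding discrete_order_def by blast
    then have xy: "strict L x y" "y \<in> Field L"
      unfolding immediate_succ_def using strict_Field by metis+
    have no: "\<not> (strict L x z \<and> strict L z y)" for z
      using y unfolding immediate_succ_def by blast
    \<comment> \<open>The point \<open>z\<close> lies strictly between \<open>x\<close> and
      \<open>b\<close>, so \<open>b\<close> is not the immediate successor of
      \<open>x\<close>.\<close>
    have "y \<noteq> b"
      using no \<open>strict L x z\<close> \<open>strict L z b\<close> by blast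
    moreover have "\<not> strict L b y"
      using no xb(1) by blast
    ultimately have yb: "strict L y b"
      using Linear_order_strict_total[OF L(1) xy(2) xb(3)] by blast
    have "I x \<subseteq> insert y (I y)"
    proof
      fix z assume "z \<in> I x"
      then have z: "strict L x z" "strict L z b" "z \<in> Field L"
        unfolding I_def using strict_Field[of L x z] by auto
      then show "z \<in> insert y (I y)"
        using no Linear_order_strict_total[OF L(1) xy(2) z(3)] unfolding I_def by blast
    qed
    then have "infinite (I y)"
      using x by (meson finite_insert finite_subset)
    then show ?thesis
      using xy yb by blast
  qed
  have "infinite (I a)"
    using inf unfolding I_def .
  then have "\<exists>g. \<forall>n. (strict L a (g n) \<and> strict L (g n) b \<and> infinite (I (g n))) \<and>
      strict L (g n) (g (Suc n))"
  proof (intro dependent_nat_choice)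
    show "\<exists>x. strict L a x \<and> strict L x b \<and> infinite (I x)"
      by (rule step) fact
    fix x and n :: nat assume x: "strict L a x \<and> strict L x b \<and> infinite (I x)"
    then obtain y where "strict L x y" "strict L y b" "infinite (I y)"
      using step by blast
    moreover from this have "strict L a y"
      using x Linear_order_strict_trans[OF L(1)] by blast
    ultimately show "\<exists>y. (strict L a y \<and> strict L y b \<and> infinite (I y)) \<and> strict L x y"
      by blast
  qed
  then show ?thesis by blast
qed

lemma children_sum_Nil: "children_sum [] = order_one"
  by (simp add: children_sum_def)

lemma copy_Nil: "copy [] k = {[k]}"
  by (simp add: copy_def children_sum_Nil Field_order_one)

lemma strict_leaf:
  "strict (directed s (tree_order (leaf s))) [j] [k] \<Longrightarrow> j < k"
proof -
  have "\<not> strict (children_sum []) [] []"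
    by (simp add: strict_def)
  then show "strict (directed s (tree_order (leaf s))) [j] [k] \<Longrightarrow> j < k"
    using strict_signed_omega[of s j k]
    by (cases s) (simp_all add: strict_tree_order)
qed

text \<open>Successors climbing from \<open>a\<close> form a copy of \<omega>, and predecessors
  descending from \<open>b\<close> form a copy of \<open>\<omega>\<^sup>*\<close>.\<close>

lemma leaf_emb_infinite_interval:
  assumes L: "Linear_order L" "discrete_order L" and inf: "infinite {z. strict L a z \<and> strict L z b}"
  shows "emb (tree_order (leaf s)) (Field (tree_order (leaf s))) L {z. strict L a z \<and> strict L z b}"
proof -
  define D where "D = directed s L"
  \<comment> \<open>Reversing \<open>L\<close> exchanges the ends of the interval, so
    \<open>c\<close> is the end from which the chain starts.\<close>
  define c where "c = (if s = Plus then a else b)"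
  define d where "d = (if s = Plus then b else a)"
  have D: "Linear_order D" "discrete_order D"
    unfolding D_def Linear_order_directed discrete_order_directed using L by auto
  have I: "{z. strict L a z \<and> strict L z b} = {z. strict D c z \<and> strict D z d}"
    unfolding D_def c_def d_def by (cases s) auto
  obtain g :: "nat \<Rightarrow> 'a" where
    g: "\<And>n. strict D c (g n)" "\<And>n. strict D (g n) d" "\<And>n. strict D (g n) (g (Suc n))"
    using successor_chain[OF D] inf unfolding I by blast
  have mono: "strict D (g j) (g k)" if "j < k" for j k
    using that
  proof (induction k)
    case (Suc k)
    then show ?case
      using g(3) Linear_order_strict_trans[OF D(1)] by (metis less_antisym)
  qed simp
  have "emb (directed s (tree_order (leaf s))) (Field (tree_order (leaf s)))
      (directed s L) {z. strict D c z \<and> strict D z d}"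
  proof (rule embI[of _ "\<lambda>u. g (hd u)"])
    fix u v assume uv: "u \<in> Field (tree_order (leaf s))" "v \<in> Field (tree_order (leaf s))"
      "strict (directed s (tree_order (leaf s))) u v"
    then obtain j k where "u = [j]" "v = [k]"
      unfolding Field_tree_order copy_Nil by blast
    then show "strict (directed s L) (g (hd u)) (g (hd v))"
      using uv(3) mono strict_leaf unfolding D_def by (metis list.sel(1))
  qed (use g in simp)
  then show ?thesis
    unfolding emb_directed I .
qed

section \<open>One-sided decompositions\<close>

text \<open>With one end open and the other closed, the intervals between consecutive members of a
  sequence abut without overlapping.\<close>

definition halfopen :: "'a rel \<Rightarrow> 'a \<Rightarrow> 'a \<Rightarrow> 'a set" where
  "halfopen L a b = {z. strict L a z \<and> (z, b) \<in> L}"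

lemma halfopen_refl: "Linear_order L \<Longrightarrow> halfopen L a a = {}"
  unfolding halfopen_def
  using Linear_order_le_less Linear_order_strict_asym by (fastforce simp: strict_def)

lemma halfopen_Un:
  assumes L: "Linear_order L" and "strict L b c" "a = b \<or> strict L a b"
  shows "halfopen L a b \<union> halfopen L b c = halfopen L a c"
proof
  have tr: "trans L"
    using L by (simp add: order_on_defs)
  have bc: "(b, c) \<in> L"
    using assms(2) by (simp add: strict_def)
  show "halfopen L a b \<union> halfopen L b c \<subseteq> halfopen L a c"
    using assms(3) bc transD[OF tr] Linear_order_strict_trans[OF L] unfolding halfopen_def by blast
  show "halfopen L a c \<subseteq> halfopen L a b \<union> halfopen L b c"
  proof
    fix z assume z: "z \<in> halfopen L a c"
    then have "z \<in> Field L" "b \<in> Field L"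
      using assms(2) strict_Field unfolding halfopen_def by fast+
    then have "strict L b z \<or> (z, b) \<in> L"
      using Linear_order_not_strict[OF L, of b z] by blast
    then show "z \<in> halfopen L a b \<union> halfopen L b c"
      using z unfolding halfopen_def by blast
  qed
qed

text \<open>Enumerate \<open>Y\<close> and choose each new term above both the previous term and the
  next element of the enumeration; this is possible as \<open>Y\<close> has no last element.\<close>

lemma cofinal_sequence:
  assumes L: "Linear_order L" and Y: "countable Y" "Y \<subseteq> Field L" "Y \<noteq> {}"
    and no_last: "\<And>y. y \<in> Y \<Longrightarrow> \<exists>z \<in> Y. strict L y z" and a: "\<And>y. y \<in> Y \<Longrightarrow> strict L a y"
  shows "\<exists>x :: nat \<Rightarrow> 'a. x 0 = a \<and>
    (\<forall>k. x (Suc k) \<in> Y \<and> strict L (x k) (x (Suc k))) \<and> (\<forall>y \<in> Y. \<exists>k. (y, x k) \<in> L)"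
proof -
  define e where "e = from_nat_into Y"
  have e: "e n \<in> Y" for n
    unfolding e_def using Y(3) by (rule from_nat_into)
  \<comment> \<open>The start \<open>a\<close> is not in \<open>Y\<close>, as it lies strictly below
    all of \<open>Y\<close>; hence the separate invariant at 0.\<close>
  have "\<exists>x. \<forall>n. (if n = 0 then x n = a else x n \<in> Y) \<and>
      (strict L (x n) (x (Suc n)) \<and> (e n, x (Suc n)) \<in> L)"
  proof (rule dependent_nat_choice)
    show "\<exists>x. if (0 :: nat) = 0 then x = a else x \<in> Y"
      by simp
    fix x and n :: nat assume x: "if n = 0 then x = a else x \<in> Y"
    have "\<exists>y \<in> Y. strict L x y"
      using x a no_last Y(3) by (cases "n = 0") auto
    then obtain y where y: "y \<in> Y" "strict L x y"
      by blast
    have F: "y \<in> Field L" "e n \<in> Field L"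
      using y e Y by auto
    show "\<exists>z. (if Suc n = 0 then z = a else z \<in> Y) \<and> (strict L x z \<and> (e n, z) \<in> L)"
    proof (cases "strict L y (e n)")
      case True
      then have "strict L x (e n)"
        using Linear_order_strict_trans[OF L y(2)] by blast
      then show ?thesis
        using e Linear_order_refl[OF L F(2)] by auto
    next
      case False
      then have "(e n, y) \<in> L"
        using Linear_order_not_strict[OF L F] by blast
      then show ?thesis
        using y by auto
    qed
  qed
  then obtain x where x: "\<And>n. if n = 0 then x n = a else x n \<in> Y"
    "\<And>n. strict L (x n) (x (Suc n))" "\<And>n. (e n, x (Suc n)) \<in> L"
    by blast
  have "\<exists>k. (y, x k) \<in> L" if "y \<in> Y" for y
  proof -
    obtain n where "y = e n"
      unfolding e_def using from_nat_into_surj[OF Y(1) \<open>y \<in> Y\<close>] by metis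
    then show ?thesis
      using x(3) by blast
  qed
  moreover have "x 0 = a" "x (Suc k) \<in> Y" for k
    using x(1)[of 0] x(1)[of "Suc k"] by simp_all
  ultimately show ?thesis
    using x(2) by blast
qed

text \<open>\<open>Y\<close> is the part of a convex set on one side of \<open>a\<close>, and
  \<open>D\<close> points away from \<open>a\<close>. If \<open>Y\<close> has a last element, it is
  one half-open interval. Otherwise a cofinal sequence cuts it into blocks, each decomposed by
  hypothesis.\<close>

lemma pieces_one_sided:
  assumes L: "Linear_order L" "discrete_order L" and F: "finite F"
    and Y: "countable Y" "Y \<subseteq> Field L"
    and D: "D = directed s L"
    and a: "\<And>y. y \<in> Y \<Longrightarrow> strict D a y"
    and convex: "\<And>y z. y \<in> Y \<Longrightarrow> strict D a z \<Longrightarrow> (z, y) \<in> D \<Longrightarrow> z \<in> Y"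
    and pc: "\<And>b c. b = a \<or> b \<in> Y \<Longrightarrow> c \<in> Y \<Longrightarrow> strict D b c \<Longrightarrow> pieces L F (halfopen D b c)"
  shows "pieces L (enlarge F) Y"
proof -
  have LD: "Linear_order D"
    unfolding D Linear_order_directed by (rule L)
  have YD: "Y \<subseteq> Field D"
    using Y unfolding D Field_directed by simp
  show ?thesis
  proof (cases "Y = {} \<or> (\<exists>y \<in> Y. \<forall>z \<in> Y. \<not> strict D y z)")
    case True
    have "pieces L F Y"
    proof (cases "Y = {}")
      case False
      then obtain y where y: "y \<in> Y" "\<forall>z \<in> Y. \<not> strict D y z"
        using True by blast
      have "(z, y) \<in> D" if "z \<in> Y" for z
        using y that Y(2) Linear_order_not_strict[OF LD, of y z] unfolding D Field_directed by blast
      then have "Y = halfopen D a y"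
        using a convex[OF y(1)] unfolding halfopen_def by blast
      then show ?thesis
        using pc[of a y] a y(1) by simp
    qed (simp add: pieces.empty)
    then show ?thesis
      using pieces_mono subset_enlarge by blast
  next
    case False
    obtain x :: "nat \<Rightarrow> 'a" where x0: "x 0 = a" and xY: "\<And>k. x (Suc k) \<in> Y"
      and xs: "\<And>k. strict D (x k) (x (Suc k))" and cof: "\<And>y. y \<in> Y \<Longrightarrow> \<exists>k. (y, x k) \<in> D"
      using cofinal_sequence[OF LD Y(1) YD _ _ a] False by metis
    have mono: "strict D (x j) (x k)" if "j < k" for j k
      using that
    proof (induction k)
      case (Suc k)
      then show ?case
        using xs Linear_order_strict_trans[OF LD] by (metis less_antisym)
    qed simp
    define X where "X k = halfopen D (x k) (x (Suc k))" for k
    \<comment> \<open>Consecutive blocks merge into a single interval, so absorption can be checked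
      in intervals of the order.\<close>
    have X_UN: "(\<Union>j \<in> {k..<l}. X j) = halfopen D (x k) (x l)" if "k \<le> l" for k l
      using that
    proof (induction l rule: dec_induct)
      case base
      then show ?case
        by (simp add: halfopen_refl[OF LD])
    next
      case (step l)
      have "(\<Union>j \<in> {k..<Suc l}. X j) = (\<Union>j \<in> {k..<l}. X j) \<union> X l"
        using step.hyps by (auto simp: atLeastLessThanSuc)
      also have "\<dots> = halfopen D (x k) (x l) \<union> halfopen D (x l) (x (Suc l))"
        unfolding step.IH unfolding X_def ..
      also have "\<dots> = halfopen D (x k) (x (Suc l))"
        using mono[of k l] step.hyps by (intro halfopen_Un[OF LD xs]) (auto simp: le_less)
      finally show ?case .
    qed
    have xlt: "strict D a (x (Suc k))" for k
      by (rule a[OF xY])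
    have X_sub: "X k \<subseteq> Y" for k
    proof
      fix z assume z: "z \<in> X k"
      then have "strict D a z"
        using xlt[of "k - 1"] x0 Linear_order_strict_trans[OF LD] unfolding X_def halfopen_def
        by (cases k) auto
      then show "z \<in> Y"
        using convex[OF xY] z unfolding X_def halfopen_def by blast
    qed
    have Y_UN: "Y = (\<Union>k. X k)"
    proof
      show "(\<Union>k. X k) \<subseteq> Y"
        using X_sub by blast
      show "Y \<subseteq> (\<Union>k. X k)"
      proof
        fix y assume y: "y \<in> Y"
        then obtain k where "(y, x k) \<in> D"
          using cof by blast
        then have "y \<in> halfopen D (x 0) (x k)"
          using a[OF y] unfolding halfopen_def x0 by blast
        then show "y \<in> (\<Union>k. X k)"
          using X_UN[of 0 k] by blast
      qed
    qed
    have X: "block_seq s L X"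
      unfolding block_seq_def before_def D[symmetric]
    proof (intro allI impI ballI)
      fix j k u v assume jk: "j < k" and u: "u \<in> X j" and v: "v \<in> X k"
      have "x (Suc j) = x k \<or> strict D (x (Suc j)) (x k)"
        using mono[of "Suc j" k] jk by (cases "Suc j = k") auto
      moreover have "u = x (Suc j) \<or> strict D u (x (Suc j))" "strict D (x k) v"
        using u v Linear_order_le_less[OF LD] unfolding X_def halfopen_def by auto
      ultimately show "strict D u v"
        using Linear_order_strict_trans[OF LD] by metis
    qed
    have pcX: "pieces L F (X k)" for k
      unfolding X_def using xY x0 by (intro pc xs) (cases k; simp)+
    \<comment> \<open>Either infinite intervals recur along the sequence, and discreteness makes
      both leaves absorbed, or from some \<open>N\<close> on all the intervals are finite.\<close>
    show ?thesis
    proof (cases "\<forall>k. \<exists>l \<ge> k. infinite (halfopen D (x k) (x l))")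
      case True
      have "absorbed (tree_order (leaf s')) (Field (tree_order (leaf s'))) L X" for s'
        unfolding absorbed_def
      proof
        fix k
        obtain l where l: "k \<le> l" "infinite (halfopen D (x k) (x l))"
          using True by blast
        define I where "I = {z. strict D (x k) z \<and> strict D z (x l)}"
        have "halfopen D (x k) (x l) \<subseteq> insert (x l) I"
          using Linear_order_le_less[OF LD] unfolding halfopen_def I_def by auto
        then have "infinite I"
          using l(2) by (meson finite_insert finite_subset)
        \<comment> \<open>For \<open>s = Minus\<close> the two ends change places. The sign
          \<open>s'\<close> of the embedded leaf is independent of the direction
          \<open>s\<close>.\<close>
        moreover have "\<exists>b c. I = {z. strict L b z \<and> strict L z c}"
          unfolding I_def D by (cases s) auto
        ultimately have "emb (tree_order (leaf s')) (Field (tree_order (leaf s'))) L I"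
          using leaf_emb_infinite_interval[OF L] by metis
        moreover have "I \<subseteq> (\<Union>j \<in> {k..<l}. X j)"
          unfolding X_UN[OF l(1)] unfolding I_def halfopen_def strict_def by blast
        ultimately show "\<exists>l \<ge> k. emb (tree_order (leaf s')) (Field (tree_order (leaf s'))) L
            (\<Union>j \<in> {k..<l}. X j)"
          using emb_mono l(1) order_refl by metis
      qed
      then show ?thesis
        unfolding Y_UN by (intro pieces_block_sequence[OF L(1) F X pcX])
    next
      case False
      \<comment> \<open>From here on the blocks are finite and nonempty, so the tail is equimorphic
        to the order of \<open>leaf s\<close>.\<close>
      then obtain N where N: "\<And>l. N \<le> l \<Longrightarrow> finite (halfopen D (x N) (x l))"
        by blast
      define Z where "Z k = X (k + N)" for k
      have Z: "block_seq s L Z"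
        unfolding Z_def by (rule block_seq_shift[OF X])
      have Z_ne: "Z k \<noteq> {}" for k
        using xs[of "k + N"] Linear_order_refl[OF LD] YD xY[of "k + N"]
        unfolding Z_def X_def halfopen_def by auto
      have Z_sub: "Z k \<subseteq> Field L" for k
        using X_sub Y(2) unfolding Z_def by blast
      have "finite (Z k)" for k
      proof -
        have "Z k \<subseteq> (\<Union>j \<in> {N..<Suc (k + N)}. X j)"
          unfolding Z_def by (intro UN_upper) simp
        then show ?thesis
          using N[of "Suc (k + N)"] X_UN[of N "Suc (k + N)"] finite_subset by (metis le_SucI le_add2)
      qed
      \<comment> \<open>With the empty set of trees only points can occur, which makes the condition
        on trees in \<open>pieces_absorbed\<close> vacuous.\<close>
      then have pcZ: "pieces L {} (Z k)" for k
        by (rule pieces_finite[OF L(1) _ Z_sub])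
      have abs: "absorbed L (Z k) (tree_order (leaf s)) (copy [])" for k
        by (rule pieces_absorbed[OF L(1) block_seq_copy copy_nonempty _ pcZ]) simp
      have abs': "absorbed (children_sum []) (Field (children_sum [])) L Z"
        unfolding children_sum_Nil Field_order_one by (rule absorbed_point[OF Z_ne])
      have "pieces L (enlarge F) (\<Union>k. Z k)"
      proof (rule pieces.tree)
        show "leaf s \<in> enlarge F"
          unfolding enlarge_def by blast
        show "(\<Union>k. Z k) \<subseteq> Field L"
          using Z_sub by blast
      qed (rule UN_emb_Node[OF L(1) Z abs abs'])+
      moreover have "pieces L (enlarge F) (\<Union>k < N. X k)"
        by (rule pieces_mono[OF pieces_UN_lessThan[OF X pcX] subset_enlarge])
      ultimately show ?thesis
        using pieces_join_directed[OF _ _ before_UN_split[OF X, of N]] UN_split[of X N]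
        unfolding Z_def Y_UN by metis
    qed
  qed
qed

section \<open>The Hausdorff equivalences\<close>

lemma segment_commute: "segment L x y = segment L y x"
  unfolding segment_def by auto

lemma segment_eq:
  assumes "Linear_order L" "(x, y) \<in> L"
  shows "segment L x y = {z. (x, z) \<in> L \<and> (z, y) \<in> L}"
proof -
  have "trans L" "antisym L"
    using assms(1) by (simp_all add: order_on_defs)
  then have "(x, z) \<in> L \<and> (z, y) \<in> L" if "(y, z) \<in> L" "(z, x) \<in> L" for z
    using that assms(2) by (meson transD)
  then show ?thesis
    unfolding segment_def by blast
qed

lemma segment_subset_Field: "segment L x y \<subseteq> Field L"
  unfolding segment_def by (auto intro: FieldI1 FieldI2)

lemma segment_self: "Linear_order L \<Longrightarrow> segment L x x \<subseteq> {x}"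
  unfolding segment_def order_on_defs by (auto dest: antisymD)

lemma segment_triangle:
  assumes L: "Linear_order L" and "x \<in> Field L" "y \<in> Field L" "z \<in> Field L"
  shows "segment L x z \<subseteq> segment L x y \<union> segment L y z"
proof
  fix u assume u: "u \<in> segment L x z"
  then have "u \<in> Field L"
    using segment_subset_Field by fast
  then have "(u, y) \<in> L \<or> (y, u) \<in> L"
    using Linear_order_not_strict[OF L _ assms(3)] assms(3) unfolding strict_def by blast
  then show "u \<in> segment L x y \<union> segment L y z"
    using u unfolding segment_def by blast
qed

lemma segment_subset:
  assumes "Linear_order L" "(x, y) \<in> L" "(y, z) \<in> L"
  shows "segment L x y \<subseteq> segment L x z"
proof -
  have tr: "trans L"
    using assms(1) by (simp add: order_on_defs)
  show ?thesis
    unfolding segment_eq[OF assms(1,2)] segment_eq[OF assms(1) transD[OF tr assms(2,3)]]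
    using assms(3) transD[OF tr] by blast
qed

lemma hausdorff_equiv_0: "hausdorff_equiv L 0 = Id_on (Field L)"
  by (subst hausdorff_equiv.simps) simp

lemma hausdorff_equiv_pos:
  "0 < n \<Longrightarrow> (x, y) \<in> hausdorff_equiv L n \<longleftrightarrow> x \<in> Field L \<and> y \<in> Field L \<and>
     (\<exists>m < n. finite (segment L x y // hausdorff_equiv L m))"
  by (subst hausdorff_equiv.simps) auto

lemma hausdorff_equiv_refl:
  assumes "Linear_order L" "x \<in> Field L"
  shows "(x, x) \<in> hausdorff_equiv L n"
proof (cases "n = 0")
  case True
  then show ?thesis using assms by (auto simp: hausdorff_equiv_0)
next
  case False
  have "segment L x x // hausdorff_equiv L 0 \<subseteq> {hausdorff_equiv L 0 `` {x}}"
    using segment_self[OF assms(1), of x] unfolding quotient_def by blast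
  then have "finite (segment L x x // hausdorff_equiv L 0)"
    using finite_subset by blast
  then show ?thesis
    using False assms(2) by (subst hausdorff_equiv_pos) auto
qed

lemma hausdorff_equiv_mono:
  assumes "Linear_order L" "m \<le> n"
  shows "hausdorff_equiv L m \<subseteq> hausdorff_equiv L n"
proof (cases "m = 0")
  case True
  then show ?thesis
    using hausdorff_equiv_refl[OF assms(1)] by (auto simp: hausdorff_equiv_0)
next
  case False
  show ?thesis
  proof
    fix p assume p: "p \<in> hausdorff_equiv L m"
    obtain x y where xy: "p = (x, y)"
      by force
    show "p \<in> hausdorff_equiv L n"
      using p False assms(2) unfolding xy
      by (simp add: hausdorff_equiv_pos) (meson order_less_le_trans)
  qed
qed

text \<open>Saturating a fine class under \<open>E'\<close> gives the coarse class of its members,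
  so the fine classes map onto the coarse ones.\<close>

lemma finite_quotient_coarser:
  assumes E: "equiv A E" and E': "equiv A E'" and sub: "E \<subseteq> E'" and S: "S \<subseteq> A" "finite (S // E)"
  shows "finite (S // E')"
proof -
  have image: "E' `` {x} = E' `` (E `` {x})" if "x \<in> A" for x
  proof
    show "E' `` {x} \<subseteq> E' `` (E `` {x})"
      using equiv_class_self[OF E that] by blast
    show "E' `` (E `` {x}) \<subseteq> E' `` {x}"
      using sub E' unfolding equiv_def by (blast dest: transD)
  qed
  have "S // E' \<subseteq> (``) E' ` (S // E)"
  proof (rule subsetI, erule quotientE)
    fix C x assume x: "C = E' `` {x}" "x \<in> S"
    have "x \<in> A"
      using x(2) S(1) by blast
    show "C \<in> (``) E' ` (S // E)"
      unfolding x(1) image[OF \<open>x \<in> A\<close>] using quotientI[OF x(2)] by (rule imageI)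
  qed
  then show ?thesis
    using S(2) finite_surj by blast
qed

text \<open>For transitivity the two witnessing levels are raised to their maximum. By the induction
  hypothesis the relations below \<open>n\<close> are equivalences, so both segments still meet
  finitely many classes there, and together they cover the third segment.\<close>

lemma equiv_hausdorff:
  assumes L: "Linear_order L"
  shows "equiv (Field L) (hausdorff_equiv L n)"
proof (induction n rule: less_induct)
  case (less n)
  show ?case
  proof (cases "n = 0")
    case True
    then show ?thesis
      by (auto simp: hausdorff_equiv_0 equiv_def refl_on_def sym_def trans_def)
  next
    case False
    note pos = hausdorff_equiv_pos[OF False[unfolded neq0_conv]]
    have "(x, z) \<in> hausdorff_equiv L n"
      if "(x, y) \<in> hausdorff_equiv L n" "(y, z) \<in> hausdorff_equiv L n" for x y z
    proof -
      obtain i j where ij: "i < n" "finite (segment L x y // hausdorff_equiv L i)"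
        "j < n" "finite (segment L y z // hausdorff_equiv L j)"
        using \<open>(x, y) \<in> _\<close> \<open>(y, z) \<in> _\<close> unfolding pos by blast
      define k where "k = max i j"
      have k: "k < n" "i \<le> k" "j \<le> k"
        unfolding k_def using ij by auto
      have coarser: "finite (S // hausdorff_equiv L k)"
        if "i' \<le> k" "S \<subseteq> Field L" "finite (S // hausdorff_equiv L i')" for i' S
        using finite_quotient_coarser[OF less.IH less.IH hausdorff_equiv_mono[OF L] that(2,3)] that(1) k(1)
        by auto
      have F: "x \<in> Field L" "y \<in> Field L" "z \<in> Field L"
        using that unfolding pos by blast+
      have "finite (segment L x y // hausdorff_equiv L k \<union> segment L y z // hausdorff_equiv L k)"
        using coarser[OF k(2) segment_subset_Field ij(2)] coarser[OF k(3) segment_subset_Field ij(4)]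
        by blast
      moreover have "segment L x z // hausdorff_equiv L k \<subseteq>
          segment L x y // hausdorff_equiv L k \<union> segment L y z // hausdorff_equiv L k"
        using segment_triangle[OF L F] unfolding quotient_def by blast
      ultimately have "finite (segment L x z // hausdorff_equiv L k)"
        using finite_subset by blast
      then show ?thesis
        unfolding pos using F k(1) by blast
    qed
    then have "trans (hausdorff_equiv L n)"
      by (rule transI)
    moreover have "sym (hausdorff_equiv L n)"
      by (rule symI) (simp add: pos segment_commute)
    moreover have "refl_on (Field L) (hausdorff_equiv L n)"
      by (rule refl_onI) (rule hausdorff_equiv_refl[OF L])
    moreover have "hausdorff_equiv L n \<subseteq> Field L \<times> Field L"
      by (rule subrelI) (simp add: pos)
    ultimately show ?thesis
      unfolding equiv_def by blast
  qed
qed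

lemma hausdorff_equiv_convex:
  assumes L: "Linear_order L" and "(x, z) \<in> hausdorff_equiv L n" "(x, y) \<in> L" "(y, z) \<in> L"
  shows "(x, y) \<in> hausdorff_equiv L n"
proof (cases "n = 0")
  case True
  then have "x = z"
    using assms(2) by (auto simp: hausdorff_equiv_0)
  then have "x = y"
    using assms unfolding order_on_defs by (meson antisymD)
  then show ?thesis
    using \<open>x = z\<close> assms(2) by simp
next
  case False
  then obtain m where m: "m < n" "finite (segment L x z // hausdorff_equiv L m)"
    using assms(2) by (auto simp: hausdorff_equiv_pos)
  have "segment L x y // hausdorff_equiv L m \<subseteq> segment L x z // hausdorff_equiv L m"
    using segment_subset[OF L assms(3,4)] unfolding quotient_def by blast
  then have "finite (segment L x y // hausdorff_equiv L m)"
    using m(2) finite_subset by blast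
  then show ?thesis
    using m(1) False assms(3) by (auto simp: hausdorff_equiv_pos intro: FieldI1 FieldI2)
qed

section \<open>Decomposing orders of finite rank\<close>

definition convex_in :: "'a rel \<Rightarrow> 'a set \<Rightarrow> bool" where
  "convex_in L X \<longleftrightarrow>
     X \<subseteq> Field L \<and> (\<forall>x \<in> X. \<forall>y \<in> X. \<forall>z. (x, z) \<in> L \<longrightarrow> (z, y) \<in> L \<longrightarrow> z \<in> X)"

lemma convex_in_directed: "convex_in (directed s L) X \<longleftrightarrow> convex_in L X"
  by (cases s) (simp_all only: directed_simps convex_in_def Field_converse converse_iff, metis)

text \<open>Convex classes are arranged one after the other. Removing the class of one point leaves
  a part below and a part above, each convex and meeting fewer classes.\<close>

lemma pieces_finitely_many_classes:
  assumes L: "Linear_order L" and E: "equiv (Field L) E"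
    and classes: "\<And>x y z. (x, z) \<in> E \<Longrightarrow> (x, y) \<in> L \<Longrightarrow> (y, z) \<in> L \<Longrightarrow> (x, y) \<in> E"
    and pc: "\<And>Z. convex_in L Z \<Longrightarrow> Z \<times> Z \<subseteq> E \<Longrightarrow> pieces L F Z"
  shows "convex_in L Y \<Longrightarrow> finite (Y // E) \<Longrightarrow> pieces L F Y"
proof (induction "card (Y // E)" arbitrary: Y rule: less_induct)
  case less
  show ?case
  proof (cases "Y = {}")
    case True
    then show ?thesis by (simp add: pieces.empty)
  next
    case False
    then obtain x where x: "x \<in> Y"
      by blast
    have Y: "Y \<subseteq> Field L"
      and Y_convex: "\<And>u v z. u \<in> Y \<Longrightarrow> v \<in> Y \<Longrightarrow> (u, z) \<in> L \<Longrightarrow> (z, v) \<in> L \<Longrightarrow> z \<in> Y"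
      using less.prems(1) unfolding convex_in_def by blast+
    have symE: "(v, u) \<in> E" if "(u, v) \<in> E" for u v
      using E that unfolding equiv_def by (blast dest: symD)
    have transE: "(u, w) \<in> E" if "(u, v) \<in> E" "(v, w) \<in> E" for u v w
      using E that unfolding equiv_def by (blast dest: transD)
    have reflE: "(u, u) \<in> E" if "u \<in> Y" for u
      using E Y that unfolding equiv_def by (blast dest: refl_onD)
    have le: "(u, v) \<in> L" if "u \<in> Y" "v \<in> Y" "\<not> strict L v u" for u v
      using Linear_order_not_strict[OF L, of v u] that Y by blast
    have strictD: "(u, v) \<in> L" if "strict L u v" for u v
      using that unfolding strict_def by blast
    define A where "A = {y \<in> Y. (x, y) \<notin> E \<and> strict L y x}"
    define B where "B = {y \<in> Y. (x, y) \<notin> E \<and> strict L x y}"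
    define C where "C = {y \<in> Y. (x, y) \<in> E}"
    \<comment> \<open>If some \<open>c\<close> in the class were at or below \<open>y\<close>, then
      \<open>y\<close> would lie between two members of the class and belong to it.\<close>
    have less_C: "strict L y c" if "y \<in> Y" "(x, y) \<notin> E" "strict L y x" "c \<in> C" for y c
    proof (rule ccontr)
      assume "\<not> strict L y c"
      then have "(c, y) \<in> L"
        using le that unfolding C_def by blast
      then have "(c, y) \<in> E"
        using classes[of c x y] that symE strictD unfolding C_def by blast
      then show False
        using that transE unfolding C_def by blast
    qed
    have C_less: "strict L c y" if "y \<in> Y" "(x, y) \<notin> E" "strict L x y" "c \<in> C" for y c
    proof (rule ccontr)
      assume "\<not> strict L c y"
      then have "(y, c) \<in> L"
        using le that unfolding C_def by blast
      then have "(x, y) \<in> E"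
        using classes[of x c y] that strictD unfolding C_def by blast
      then show False
        using that by blast
    qed
    have xC: "x \<in> C"
      using x reflE unfolding C_def by blast
    have convA: "convex_in L A"
      unfolding convex_in_def
    proof (intro conjI ballI allI impI)
      show "A \<subseteq> Field L"
        using Y unfolding A_def by blast
      fix u v z assume uv: "u \<in> A" "v \<in> A" "(u, z) \<in> L" "(z, v) \<in> L"
      then have zY: "z \<in> Y"
        using Y_convex unfolding A_def by blast
      have zx: "strict L z x"
        using uv Linear_order_strict_trans[OF L, of z v x] Linear_order_le_less[OF L, of z v]
        unfolding A_def by blast
      moreover have "(x, z) \<notin> E"
      proof
        assume "(x, z) \<in> E"
        then have "strict L v z"
          using less_C[of v z] uv zY unfolding A_def C_def by blast
        then show False
          using uv(4) Linear_order_strict_asym[OF L] Linear_order_le_less[OF L, of z v]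
          unfolding strict_def by blast
      qed
      ultimately show "z \<in> A"
        using zY unfolding A_def by blast
    qed
    have convB: "convex_in L B"
      unfolding convex_in_def
    proof (intro conjI ballI allI impI)
      show "B \<subseteq> Field L"
        using Y unfolding B_def by blast
      fix u v z assume uv: "u \<in> B" "v \<in> B" "(u, z) \<in> L" "(z, v) \<in> L"
      then have zY: "z \<in> Y"
        using Y_convex unfolding B_def by blast
      have zx: "strict L x z"
        using uv Linear_order_strict_trans[OF L, of x u z] Linear_order_le_less[OF L, of u z]
        unfolding B_def by blast
      moreover have "(x, z) \<notin> E"
      proof
        assume "(x, z) \<in> E"
        then have "strict L z u"
          using C_less[of u z] uv zY unfolding B_def C_def by blast
        then show False
          using uv(3) Linear_order_strict_asym[OF L] Linear_order_le_less[OF L, of u z]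
          unfolding strict_def by blast
      qed
      ultimately show "z \<in> B"
        using zY unfolding B_def by blast
    qed
    have convC: "convex_in L C"
      unfolding convex_in_def
    proof (intro conjI ballI allI impI)
      show "C \<subseteq> Field L"
        using Y unfolding C_def by blast
      fix u v z assume uv: "u \<in> C" "v \<in> C" "(u, z) \<in> L" "(z, v) \<in> L"
      then have "(u, v) \<in> E"
        using symE transE unfolding C_def by blast
      then have "(u, z) \<in> E"
        using classes uv by blast
      then show "z \<in> C"
        using uv Y_convex transE unfolding C_def by blast
    qed
    have pcC: "pieces L F C"
      using pc[OF convC] symE transE unfolding C_def by blast
    have smaller: "card (Z // E) < card (Y // E)" "finite (Z // E)"
      if "Z \<subseteq> Y" "\<And>z. z \<in> Z \<Longrightarrow> (x, z) \<notin> E" for Z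
    proof -
      have "E `` {x} \<in> Y // E"
        using x by (rule quotientI)
      moreover have "E `` {x} \<notin> Z // E"
      proof
        assume "E `` {x} \<in> Z // E"
        then obtain z where z: "z \<in> Z" "E `` {x} = E `` {z}"
          unfolding quotient_def by blast
        then have "(x, z) \<in> E"
          using reflE that(1) by blast
        then show False
          using that(2) z(1) by blast
      qed
      moreover have "Z // E \<subseteq> Y // E"
        using that(1) unfolding quotient_def by blast
      ultimately have "Z // E \<subset> Y // E"
        by blast
      then show "card (Z // E) < card (Y // E)" "finite (Z // E)"
        using less.prems(2) psubset_card_mono finite_subset by blast+
    qed
    have "pieces L F A"
      by (intro less.hyps convA smaller) (auto simp: A_def)
    moreover have "pieces L F B"
      by (intro less.hyps convB smaller) (auto simp: B_def)
    moreover have "before L A C"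
      using less_C unfolding before_def A_def by blast
    \<comment> \<open>The sets \<open>A\<close> and \<open>B\<close> are compared through the point
      \<open>x\<close>.\<close>
    moreover have "before L (A \<union> C) B"
      using C_less xC Linear_order_strict_trans[OF L] unfolding before_def A_def B_def by blast
    ultimately have "pieces L F ((A \<union> C) \<union> B)"
      using pcC by (intro pieces.join)
    moreover have "(A \<union> C) \<union> B = Y"
      using Linear_order_strict_total[OF L] Y x reflE unfolding A_def B_def C_def by blast
    ultimately show ?thesis by simp
  qed
qed

text \<open>Cut \<open>X\<close> at one of its points \<open>a\<close>. The two sides are one-sided
  sets whose half-open intervals are bounded by points of \<open>X\<close>, so
  \<open>pieces_one_sided\<close> applies to each, with \<open>Minus\<close> for the lower
  side.\<close>

lemma pieces_bounded_imp_pieces: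
  assumes L: "Linear_order L" "discrete_order L" "countable (Field L)" and F: "finite F"
    and X: "convex_in L X"
    and pc: "\<And>x y Z. x \<in> X \<Longrightarrow> y \<in> X \<Longrightarrow> convex_in L Z \<Longrightarrow> Z \<subseteq> segment L x y \<Longrightarrow> pieces L F Z"
  shows "pieces L (enlarge F) X"
proof (cases "X = {}")
  case True
  then show ?thesis by (simp add: pieces.empty)
next
  case False
  then obtain a where a: "a \<in> X"
    by blast
  have X_Field: "X \<subseteq> Field L"
    and X_convex: "\<And>u v z. u \<in> X \<Longrightarrow> v \<in> X \<Longrightarrow> (u, z) \<in> L \<Longrightarrow> (z, v) \<in> L \<Longrightarrow> z \<in> X"
    using X unfolding convex_in_def by blast+
  have transL: "(u, w) \<in> L" if "(u, v) \<in> L" "(v, w) \<in> L" for u v w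
    using L(1) that unfolding order_on_defs by (blast dest: transD)
  define Y where "Y s = {z \<in> X. strict (directed s L) a z}" for s
  have "pieces L (enlarge F) (Y s)" for s
  proof (rule pieces_one_sided[OF L(1,2) F _ _ refl])
    let ?D = "directed s L"
    have LD: "Linear_order ?D"
      unfolding Linear_order_directed by (rule L(1))
    show sub: "Y s \<subseteq> Field L"
      using X_Field unfolding Y_def by blast
    show "countable (Y s)"
      by (rule countable_subset[OF sub L(3)])
    show "strict ?D a y" if "y \<in> Y s" for y
      using that unfolding Y_def by blast
    have convex_D: "z \<in> X" if "u \<in> X" "v \<in> X" "(u, z) \<in> ?D" "(z, v) \<in> ?D" for u v z
      using X_convex[OF that(1,2), of z] X_convex[OF that(2,1), of z] that(3,4) by (cases s) simp_all
    show "z \<in> Y s" if "y \<in> Y s" "strict ?D a z" "(z, y) \<in> ?D" for y z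
      using that convex_D[OF a, of y z] unfolding Y_def strict_def by blast
    fix b c assume bc: "b = a \<or> b \<in> Y s" "c \<in> Y s" "strict ?D b c"
    have D_trans: "(u, w) \<in> ?D" if "(u, v) \<in> ?D" "(v, w) \<in> ?D" for u v w
      using transL[of u v w] transL[of w v u] that by (cases s) simp_all
    have "convex_in ?D (halfopen ?D b c)"
      unfolding convex_in_def
    proof (intro conjI ballI allI impI)
      show "halfopen ?D b c \<subseteq> Field ?D"
        unfolding halfopen_def by (auto intro: FieldI1)
      fix u v z assume "u \<in> halfopen ?D b c" "v \<in> halfopen ?D b c" "(u, z) \<in> ?D" "(z, v) \<in> ?D"
      then show "z \<in> halfopen ?D b c"
        using Linear_order_strict_trans[OF LD] Linear_order_le_less[OF LD, of u z] D_trans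
        unfolding halfopen_def by blast
    qed
    then have "convex_in L (halfopen ?D b c)"
      unfolding convex_in_directed .
    moreover have "halfopen ?D b c \<subseteq> segment L b c"
      unfolding halfopen_def segment_def strict_def by (cases s) auto
    moreover have "b \<in> X" "c \<in> X"
      using bc a unfolding Y_def by blast+
    ultimately show "pieces L F (halfopen ?D b c)"
      using pc by blast
  qed
  note sides = this
  have "pieces L (enlarge F) (Y Minus \<union> {a})"
    using a X_Field by (intro pieces.join pieces.point sides) (auto simp: before_def Y_def)
  moreover have "before L (Y Minus \<union> {a}) (Y Plus)"
    using Linear_order_strict_trans[OF L(1)] unfolding before_def Y_def directed_simps strict_converse
    by blast
  ultimately have "pieces L (enlarge F) ((Y Minus \<union> {a}) \<union> Y Plus)"
    by (intro pieces.join[OF _ sides])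
  moreover have "(Y Minus \<union> {a}) \<union> Y Plus = X"
    using a X_Field Linear_order_strict_total[OF L(1)]
    unfolding Y_def directed_simps strict_converse by blast
  ultimately show ?thesis by simp
qed

text \<open>One finite set \<open>F\<close> must serve all \<open>X\<close> at once: a step in rank
  meets infinitely many blocks, and only a common finite supply of trees lets some tail contain
  recurring trees alone.\<close>

lemma pieces_hausdorff_class:
  assumes L: "Linear_order L" "discrete_order L" "countable (Field L)"
  shows "\<exists>F. finite F \<and> (\<forall>t \<in> F. alternating_tree t) \<and>
    (\<forall>X. convex_in L X \<longrightarrow> X \<times> X \<subseteq> hausdorff_equiv L n \<longrightarrow> pieces L F X)"
proof (induction n rule: less_induct)
  case (less n)
  show ?case
  proof (cases "n = 0")
    case True
    have "pieces L {} X" if X: "convex_in L X" "X \<times> X \<subseteq> hausdorff_equiv L n" for X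
    proof (cases "X = {}")
      case False
      then obtain x where x: "x \<in> X"
        by blast
      then have "X = {x}"
        using X(2) unfolding True hausdorff_equiv_0 by blast
      then show ?thesis
        using X(1) unfolding convex_in_def by (auto intro: pieces.point)
    qed (simp add: pieces.empty)
    then show ?thesis
      by (intro exI[of _ "{}"]) blast
  next
    case False
    have "\<forall>m \<in> {..<n}. \<exists>F. finite F \<and> (\<forall>t \<in> F. alternating_tree t) \<and>
        (\<forall>X. convex_in L X \<longrightarrow> X \<times> X \<subseteq> hausdorff_equiv L m \<longrightarrow> pieces L F X)"
      using less.IH by (intro ballI) (simp only: lessThan_iff)
    then obtain F where F_all: "\<forall>m \<in> {..<n}. finite (F m) \<and> (\<forall>t \<in> F m. alternating_tree t) \<and>
        (\<forall>X. convex_in L X \<longrightarrow> X \<times> X \<subseteq> hausdorff_equiv L m \<longrightarrow> pieces L (F m) X)"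
      by (rule bchoice[THEN exE])
    have F: "finite (F m)" "t \<in> F m \<Longrightarrow> alternating_tree t"
      "convex_in L X \<Longrightarrow> X \<times> X \<subseteq> hausdorff_equiv L m \<Longrightarrow> pieces L (F m) X"
      if "m < n" for m t X
      using bspec[OF F_all, of m] that by simp_all
    \<comment> \<open>The level \<open>m\<close> that witnesses an equivalence varies with the pair
      of points, so the trees of all lower levels are collected.\<close>
    define G where "G = (\<Union>m < n. F m)"
    have G: "finite G" "\<And>t. t \<in> G \<Longrightarrow> alternating_tree t"
      unfolding G_def using F(1,2) by auto
    have "pieces L (enlarge G) X" if X: "convex_in L X" "X \<times> X \<subseteq> hausdorff_equiv L n" for X
    proof (rule pieces_bounded_imp_pieces[OF L G(1) X(1)])
      fix x y Z assume "x \<in> X" "y \<in> X" and Z: "convex_in L Z" "Z \<subseteq> segment L x y"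
      then have "(x, y) \<in> hausdorff_equiv L n"
        using X(2) by blast
      then obtain m where m: "m < n" "finite (segment L x y // hausdorff_equiv L m)"
        using False by (auto simp: hausdorff_equiv_pos)
      have "Z // hausdorff_equiv L m \<subseteq> segment L x y // hausdorff_equiv L m"
        using Z(2) unfolding quotient_def by blast
      then have fin: "finite (Z // hausdorff_equiv L m)"
        using m(2) finite_subset by blast
      have "pieces L (F m) Z"
        by (rule pieces_finitely_many_classes[OF L(1) equiv_hausdorff[OF L(1)]
              hausdorff_equiv_convex[OF L(1)] F(3)[OF m(1)] Z(1) fin])
      then show "pieces L G Z"
        by (rule pieces_mono) (use m(1) in \<open>auto simp: G_def\<close>)
    qed
    then show ?thesis
      using finite_enlarge[OF G(1)] alternating_enlarge[OF G] by (intro exI[of _ "enlarge G"]) blast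
  qed
qed

text \<open>The induction is over the decomposition, for any set \<open>X\<close> into which
  \<open>L\<close> embeds. Indecomposability moves the embedding into one side of each join;
  infinity of \<open>L\<close> excludes ending in a point, so it ends in a tree piece. That piece
  lies in \<open>L\<close>, which gives the converse embedding.\<close>

lemma indecomposable_pieces:
  assumes L: "Linear_order L" "infinite (Field L)" "indecomposable L"
  shows "pieces L F X \<Longrightarrow> emb L (Field L) L X \<Longrightarrow> \<exists>t \<in> F.
    emb L (Field L) (tree_order t) (Field (tree_order t)) \<and>
    emb (tree_order t) (Field (tree_order t)) L (Field L)"
proof (induction rule: pieces.induct)
  case empty
  then have "Field L = {}"
    unfolding emb_def by auto
  then show ?case
    using L(2) by simp
next
  case (point x)
  obtain f where f: "\<forall>y \<in> Field L. f y \<in> {x}"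
    "\<forall>y \<in> Field L. \<forall>z \<in> Field L. strict L y z \<longrightarrow> strict L (f y) (f z)"
    using point.prems by (rule embE)
  obtain y where y: "y \<in> Field L"
    using L(2) by (metis ex_in_conv finite.emptyI)
  have "infinite (Field L - {y})"
    using L(2) by simp
  then obtain z where "z \<in> Field L" "z \<noteq> y"
    by (metis Diff_iff ex_in_conv finite.emptyI singletonI)
  moreover from this have "f y = x" "f z = x"
    using f(1) y by auto
  ultimately have "strict L x x"
    using f(2) y Linear_order_strict_total[OF L(1), of y z] by metis
  then show ?case
    by (simp add: strict_def)
next
  case (tree t X)
  then have "emb L (Field L) (tree_order t) (Field (tree_order t))"
    using emb_trans by blast
  moreover have "emb (tree_order t) (Field (tree_order t)) L (Field L)"
    using emb_mono[OF tree.hyps(4) order_refl tree.hyps(2)] .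
  ultimately show ?case
    using tree.hyps(1) by blast
next
  case (join X Y)
  \<comment> \<open>Indecomposability speaks of abstract sums, so the two sides are turned into
    orders of their own on the same type.\<close>
  define A where "A = Restr L X"
  define B where "B = Restr L Y"
  have lin: "Linear_order A" "Linear_order B"
    unfolding A_def B_def by (auto intro: Linear_order_Restr[OF L(1)])
  have sub: "X \<subseteq> Field L" "Y \<subseteq> Field L"
    using join.hyps pieces_subset_Field by blast+
  have FA: "Field A = X" and FB: "Field B = Y"
    unfolding A_def B_def Field_def
    using sub Linear_order_refl[OF L(1)] by blast+
  have sA: "strict A u v \<longleftrightarrow> strict L u v \<and> u \<in> X \<and> v \<in> X" for u v
    unfolding A_def strict_def by blast
  have sB: "strict B u v \<longleftrightarrow> strict L u v \<and> u \<in> Y \<and> v \<in> Y" for u v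
    unfolding B_def strict_def by blast
  obtain f where f: "\<forall>u \<in> Field L. f u \<in> X \<union> Y"
    "\<forall>u \<in> Field L. \<forall>v \<in> Field L. strict L u v \<longrightarrow> strict L (f u) (f v)"
    using join.prems by (rule embE)
  define h where "h u = (if f u \<in> X then Inl (f u) else Inr (f u))" for u
  have h: "(h u, h v) \<in> order_sum A B \<and> (u \<noteq> v \<longrightarrow> h u \<noteq> h v)" if "(u, v) \<in> L" for u v
  proof -
    have uv: "u \<in> Field L" "v \<in> Field L"
      using that by (auto intro: FieldI1 FieldI2)
    have in_XY: "f u \<in> X \<or> f u \<in> Y" "f v \<in> X \<or> f v \<in> Y"
      using f(1) uv by blast+
    have le: "(f u, f v) \<in> L \<and> (u \<noteq> v \<longrightarrow> f u \<noteq> f v)"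
      using f(2) uv that in_XY sub Linear_order_refl[OF L(1)] unfolding strict_def by blast
    \<comment> \<open>Since \<open>X\<close> precedes \<open>Y\<close>, the map \<open>f\<close>
      cannot send a smaller element into \<open>Y\<close> and a larger one into \<open>X\<close>;
      hence \<open>h\<close> respects the sum.\<close>
    have "\<not> (f v \<in> X \<and> f u \<in> Y \<and> f u \<notin> X)"
    proof
      assume *: "f v \<in> X \<and> f u \<in> Y \<and> f u \<notin> X"
      then have "strict L (f v) (f u)"
        using join.hyps(3) unfolding before_def by blast
      moreover have "strict L (f u) (f v)"
        using le * unfolding strict_def by auto
      ultimately show False
        using Linear_order_strict_asym[OF L(1)] by blast
    qed
    then have "(h u, h v) \<in> order_sum A B"
      using in_XY le unfolding h_def order_sum_def FA FB by (auto simp: A_def B_def)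
    moreover have "h u \<noteq> h v" if "u \<noteq> v"
      using le that unfolding h_def by auto
    ultimately show ?thesis by blast
  qed
  have "embeds L (order_sum A B)"
    unfolding embeds_def
  proof (intro exI[of _ h] conjI allI impI)
    show "h ` Field L \<subseteq> Field (order_sum A B)"
      using h Linear_order_refl[OF L(1)] by (blast intro: FieldI1)
    show "inj_on h (Field L)"
    proof (rule inj_onI)
      fix u v assume *: "u \<in> Field L" "v \<in> Field L" "h u = h v"
      show "u = v"
      proof (rule ccontr)
        assume "u \<noteq> v"
        then have "strict L u v \<or> strict L v u"
          using Linear_order_strict_total[OF L(1)] * by blast
        then show False
          using h[of u v] h[of v u] * unfolding strict_def by metis
      qed
    qed
  qed (use h in blast)
  then have "embeds L A \<or> embeds L B"
    using L(3) lin unfolding indecomposable_def by blast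
  then have "emb L (Field L) A X \<or> emb L (Field L) B Y"
    using embeds_iff_emb[OF L(1) lin(1)] embeds_iff_emb[OF L(1) lin(2)] unfolding FA FB by blast
  moreover have "emb A X L X" "emb B Y L Y"
    by (rule embI[of _ "\<lambda>u. u"]; simp add: sA sB)+
  ultimately have "emb L (Field L) L X \<or> emb L (Field L) L Y"
    using emb_trans by blast
  then show ?case
    using join.IH by blast
qed

theorem theorem4p7:
  fixes L :: "'a rel"
  assumes "Linear_order L"
    and "infinite (Field L)"
    and "countable (Field L)"
    and "discrete_order L"
    and "indecomposable L"
    and "scattered L"
    and "finite_hausdorff_rank L"
  shows "\<exists>T s. finite_tree T \<and> standard_labelling T \<and> alternating T s \<and>
           equimorphic L (LIN T s [])"
proof -
  obtain n where n: "finite (Field L // hausdorff_equiv L n)"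
    using assms(7) unfolding finite_hausdorff_rank_def by blast
  obtain F where F: "\<And>t. t \<in> F \<Longrightarrow> alternating_tree t"
    "\<And>X. convex_in L X \<Longrightarrow> X \<times> X \<subseteq> hausdorff_equiv L n \<Longrightarrow> pieces L F X"
    using pieces_hausdorff_class[OF assms(1,4,3), of n] by blast
  \<comment> \<open>The whole order is convex and, by the choice of \<open>n\<close>, meets finitely
    many classes, so it is itself a finite sum of pieces.\<close>
  have "convex_in L (Field L)"
    unfolding convex_in_def by (auto intro: FieldI1 FieldI2)
  then have "pieces L F (Field L)"
    by (intro pieces_finitely_many_classes[OF assms(1) equiv_hausdorff[OF assms(1)]
          hausdorff_equiv_convex[OF assms(1)] F(2) _ n])
  moreover have "emb L (Field L) L (Field L)"
    by (rule embI[of _ "\<lambda>x. x"])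
  ultimately obtain t where t: "t \<in> F" "emb L (Field L) (tree_order t) (Field (tree_order t))"
    "emb (tree_order t) (Field (tree_order t)) L (Field L)"
    using indecomposable_pieces[OF assms(1,2,5)] by blast
  have "LIN (nodes t) (node_sign t) [] = tree_order t"
    by (rule LIN_nodes) simp
  moreover have "equimorphic L (tree_order t)"
    unfolding equimorphic_def
    using t(2,3) embeds_iff_emb[OF assms(1) Linear_order_tree_order]
      embeds_iff_emb[OF Linear_order_tree_order assms(1)] by blast
  ultimately show ?thesis
    using finite_tree_nodes standard_labelling_nodes alternating_nodes[OF F(1)[OF t(1)]] by metis
qed

end
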